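(* Let $\mathsf{Val} \in \{\mathsf{LimInf}, \mathsf{LimSup}\}$. Given a deterministic $\mathsf{Val}$-automaton $\mathcal{A}$ over an alphabet $\Sigma$, one can construct in polynomial time a deterministic safe $\mathsf{Val}$-automaton $\mathcal{B}$ and a deterministic live $\mathsf{Val}$-automaton $\mathcal{C}$ such that $\mathcal{A}(w) = \min(\mathcal{B}(w), \mathcal{C}(w))$ for every infinite word $w \in \Sigma^\omega$.
   Context: $u \prec w$ means that the finite word $u$ is a strict prefix of $w$ (possibly empty). A quantitative automaton is a tuple $\mathcal{A} = (\Sigma, Q, \iota, \delta)$ with a finite alphabet $\Sigma$, a finite nonempty set $Q$ of states, an initial state $\iota \in Q$, and a transition function $\delta : Q \times \Sigma \to 2^{\mathbb{Q} \times Q}$ with finite nonempty values. It is deterministic if every $\delta(q,\sigma)$ is a singleton. A run on $w = w[0]w[1]\ldots \in \Sigma^\omega$ is a sequence of transitions $(q_i, w[i], x_i, q_{i+1})_{i \geq 0}$ with $q_0 = \iota$ and $(x_i, q_{i+1}) \in \delta(q_i, w[i])$; it yields the weight sequence $x_0 x_1 \ldots$. In a $\mathsf{Val}$-automaton the value of a run is $\mathsf{Val}$ of its weight sequence, and $\mathcal{A}(w)$ is the supremum of the values of all runs of $\mathcal{A}$ on $w$ (so the value of the unique run if $\mathcal{A}$ is deterministic). Here $\mathsf{LimInf}(v) = \liminf_n v_n$ and $\mathsf{LimSup}(v) = \limsup_n v_n$. The size of an automaton is the maximum of the sizes of its alphabet, state space and transition space, with weights represented in binary. An automaton $\mathcal{A}$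 is safe when for every $w \in \Sigma^\omega$ and $v \in \mathbb{R}$ with $\mathcal{A}(w) < v$ there is $u \prec w$ with $\sup_{w' \in \Sigma^\omega} \mathcal{A}(uw') < v$. With $\top_{\mathcal{A}} = \sup_{w \in \Sigma^\omega} \mathcal{A}(w)$, an automaton $\mathcal{A}$ is live when for all $w \in \Sigma^\omega$ with $\mathcal{A}(w) < \top_{\mathcal{A}}$ there exists $v \in \mathbb{R}$ with $\mathcal{A}(w) < v$ such that for all $u \prec w$ we have $\sup_{w' \in \Sigma^\omega} \mathcal{A}(uw') \geq v$. *)

theory Defs
  imports
    Complex_Main
    "HOL-Library.Extended_Real"
    "HOL-Library.Omega_Words_Fun"
    "HOL-Computational_Algebra.Polynomial"
begin

section \<open>Quantitative automata\<close>

record ('s, 'q) qaut =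
  alphabet :: "'s set"
  states :: "'q set"
  initial :: 'q
  delta :: "'q \<Rightarrow> 's \<Rightarrow> (rat \<times> 'q) set"

text \<open>
  The components are meaningful only on the carriers: \<open>delta A q a\<close> is constrained, and used,
  only for \<open>q \<in> states A\<close> and \<open>a \<in> alphabet A\<close>.
\<close>

definition quant_aut :: "('s, 'q) qaut \<Rightarrow> bool" where
  "quant_aut A \<longleftrightarrow>
     finite (alphabet A) \<and> finite (states A) \<and> initial A \<in> states A \<and>
     (\<forall>q\<in>states A. \<forall>a\<in>alphabet A.
        finite (delta A q a) \<and> delta A q a \<noteq> {} \<and> delta A q a \<subseteq> UNIV \<times> states A)"

definition deterministic :: "('s, 'q) qaut \<Rightarrow> bool" where
  "deterministic A \<longleftrightarrow> (\<forall>q\<in>states A. \<forall>a\<in>alphabet A. is_singleton (delta A q a))"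

definition omega_words :: "'s set \<Rightarrow> 's word set" where
  "omega_words S = {w. \<forall>i. w i \<in> S}"

text \<open>
  The run \<open>(q\<^sub>i, w i, x\<^sub>i, q\<^sub>i\<^sub>+\<^sub>1)\<^sub>i\<close> is represented by its sequence of states and
  its sequence of weights.
\<close>

definition runs :: "('s, 'q) qaut \<Rightarrow> 's word \<Rightarrow> ((nat \<Rightarrow> 'q) \<times> (nat \<Rightarrow> rat)) set" where
  "runs A w = {(q, x). q 0 = initial A \<and> (\<forall>i. (x i, q (Suc i)) \<in> delta A (q i) (w i))}"

type_synonym value_function = "(nat \<Rightarrow> rat) \<Rightarrow> ereal"

definition LimInf :: value_function where
  "LimInf v = liminf (\<lambda>n. ereal (real_of_rat (v n)))"

definition LimSup :: value_function where
  "LimSup v = limsup (\<lambda>n. ereal (real_of_rat (v n)))"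

definition aut_val :: "value_function \<Rightarrow> ('s, 'q) qaut \<Rightarrow> 's word \<Rightarrow> ereal" where
  "aut_val Val A w = (SUP (q, x)\<in>runs A w. Val x)"

definition strict_prefix_of :: "'s list \<Rightarrow> 's word \<Rightarrow> bool" (infix \<open>\<prec>\<close> 50) where
  "u \<prec> w \<longleftrightarrow> (\<exists>n. u = prefix n w)"

definition safe_aut :: "value_function \<Rightarrow> ('s, 'q) qaut \<Rightarrow> bool" where
  "safe_aut Val A \<longleftrightarrow>
     (\<forall>w\<in>omega_words (alphabet A). \<forall>v::real. aut_val Val A w < ereal v \<longrightarrow>
        (\<exists>u. u \<prec> w \<and> (SUP w'\<in>omega_words (alphabet A). aut_val Val A (u \<frown> w')) < ereal v))"

definition top_val :: "value_function \<Rightarrow> ('s, 'q) qaut \<Rightarrow> ereal" where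
  "top_val Val A = (SUP w\<in>omega_words (alphabet A). aut_val Val A w)"

definition live_aut :: "value_function \<Rightarrow> ('s, 'q) qaut \<Rightarrow> bool" where
  "live_aut Val A \<longleftrightarrow>
     (\<forall>w\<in>omega_words (alphabet A). aut_val Val A w < top_val Val A \<longrightarrow>
        (\<exists>v::real. aut_val Val A w < ereal v \<and>
           (\<forall>u. u \<prec> w \<longrightarrow>
              (SUP w'\<in>omega_words (alphabet A). aut_val Val A (u \<frown> w')) \<ge> ereal v)))"


section \<open>Size of an automaton\<close>

text \<open>Binary digits, least significant digit first, without leading zeros.\<close>

fun bits :: "nat \<Rightarrow> bool list" where
  "bits n = (if n = 0 then [] else odd n # bits (n div 2))"

declare bits.simps [simp del]

definition weight_size :: "rat \<Rightarrow> nat" where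
  "weight_size x =
     (case quotient_of x of (a, b) \<Rightarrow> 1 + length (bits (nat \<bar>a\<bar>)) + length (bits (nat b)))"

definition transitions :: "('s, 'q) qaut \<Rightarrow> ('q \<times> 's \<times> rat \<times> 'q) set" where
  "transitions A =
     {(q, a, x, q'). q \<in> states A \<and> a \<in> alphabet A \<and> (x, q') \<in> delta A q a}"

definition aut_size :: "('s, 'q) qaut \<Rightarrow> nat" where
  "aut_size A = Max {card (alphabet A), card (states A),
     \<Sum>(q, a, x, q')\<in>transitions A. weight_size x}"


section \<open>Polynomial time\<close>

text \<open>
  The model of computation is the language of while programs over binary trees with a single
  atom (N. D. Jones, Computability and Complexity from a Programming Perspective, MIT Press
  1997), with its unit-cost time measure: every operator in an expression, every assignment and
  every test takes one step, and a test only inspects whether a tree is the atom. Trees are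
  pointer structures with sharing, so each step is a constant number of pointer operations, and
  the model is polynomially equivalent to Turing machines. Because of sharing, a tree built in
  \<open>n\<close> steps may have more than polynomially many nodes in \<open>n\<close> when it is written out;
  \<open>computes_within\<close> therefore also charges the number of nodes of the result.
\<close>

datatype tree = Atom | Cell tree tree

datatype expr = Var nat | Nil_Expr | Cons_Expr expr expr | Hd_Expr expr | Tl_Expr expr

datatype com =
    Skip
  | Assign nat expr
  | Seq com com
  | Cond expr com com
  | While expr com

type_synonym store = "nat \<Rightarrow> tree"

fun left :: "tree \<Rightarrow> tree" where
  "left Atom = Atom"
| "left (Cell l r) = l"

fun right :: "tree \<Rightarrow> tree" where
  "right Atom = Atom"
| "right (Cell l r) = r"

fun eval_expr :: "expr \<Rightarrow> store \<Rightarrow> tree" where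
  "eval_expr (Var i) s = s i"
| "eval_expr Nil_Expr s = Atom"
| "eval_expr (Cons_Expr e f) s = Cell (eval_expr e s) (eval_expr f s)"
| "eval_expr (Hd_Expr e) s = left (eval_expr e s)"
| "eval_expr (Tl_Expr e) s = right (eval_expr e s)"

fun expr_cost :: "expr \<Rightarrow> nat" where
  "expr_cost (Var i) = 1"
| "expr_cost Nil_Expr = 1"
| "expr_cost (Cons_Expr e f) = 1 + expr_cost e + expr_cost f"
| "expr_cost (Hd_Expr e) = 1 + expr_cost e"
| "expr_cost (Tl_Expr e) = 1 + expr_cost e"

text \<open>\<open>exec c s n s'\<close>: started in store \<open>s\<close>, the program \<open>c\<close> halts after \<open>n\<close> steps in
  store \<open>s'\<close>.\<close>

inductive exec :: "com \<Rightarrow> store \<Rightarrow> nat \<Rightarrow> store \<Rightarrow> bool" where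
  Skip: "exec Skip s 1 s"
| Assign: "exec (Assign i e) s (1 + expr_cost e) (s(i := eval_expr e s))"
| Seq: "exec c s m s' \<Longrightarrow> exec d s' n s'' \<Longrightarrow> exec (Seq c d) s (m + n) s''"
| CondTrue: "eval_expr e s \<noteq> Atom \<Longrightarrow> exec c s n s' \<Longrightarrow>
    exec (Cond e c d) s (1 + expr_cost e + n) s'"
| CondFalse: "eval_expr e s = Atom \<Longrightarrow> exec d s n s' \<Longrightarrow>
    exec (Cond e c d) s (1 + expr_cost e + n) s'"
| WhileFalse: "eval_expr e s = Atom \<Longrightarrow> exec (While e c) s (1 + expr_cost e) s"
| WhileTrue: "eval_expr e s \<noteq> Atom \<Longrightarrow> exec c s m s' \<Longrightarrow> exec (While e c) s' n s'' \<Longrightarrow>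
    exec (While e c) s (1 + expr_cost e + m + n) s''"

fun nodes :: "tree \<Rightarrow> nat" where
  "nodes Atom = 1"
| "nodes (Cell l r) = 1 + nodes l + nodes r"

text \<open>Input and output are passed in variable 0; all other variables initially hold the atom.\<close>

definition computes_within :: "com \<Rightarrow> tree \<Rightarrow> nat \<Rightarrow> tree \<Rightarrow> bool" where
  "computes_within P t T t' \<longleftrightarrow>
     (\<exists>n s. exec P ((\<lambda>_. Atom)(0 := t)) n s \<and> s 0 = t' \<and> n + nodes t' \<le> T)"


section \<open>Automata as inputs and outputs of programs\<close>

fun tree_of_list :: "tree list \<Rightarrow> tree" where
  "tree_of_list [] = Atom"
| "tree_of_list (t # ts) = Cell t (tree_of_list ts)"

definition tree_of_bool :: "bool \<Rightarrow> tree" where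
  "tree_of_bool b = (if b then Cell Atom Atom else Atom)"

definition tree_of_nat :: "nat \<Rightarrow> tree" where
  "tree_of_nat n = tree_of_list (map tree_of_bool (bits n))"

definition tree_of_int :: "int \<Rightarrow> tree" where
  "tree_of_int z = Cell (tree_of_bool (z < 0)) (tree_of_nat (nat \<bar>z\<bar>))"

definition tree_of_rat :: "rat \<Rightarrow> tree" where
  "tree_of_rat x = (case quotient_of x of (a, b) \<Rightarrow> Cell (tree_of_int a) (tree_of_nat (nat b)))"

fun tree_of_transition :: "nat \<times> nat \<times> rat \<times> nat \<Rightarrow> tree" where
  "tree_of_transition (i, k, x, j) =
     tree_of_list [tree_of_nat i, tree_of_nat k, tree_of_rat x, tree_of_nat j]"

text \<open>
  The lists \<open>ls\<close> and \<open>qs\<close> enumerate the letters and the states, which are named in the tree by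
  their positions in these lists, so the names do not contribute to the size of the input. The
  transitions may be listed in any order.
\<close>

definition represents :: "tree \<Rightarrow> 's list \<Rightarrow> 'q list \<Rightarrow> ('s, 'q) qaut \<Rightarrow> bool" where
  "represents t ls qs A \<longleftrightarrow>
     distinct ls \<and> set ls = alphabet A \<and> distinct qs \<and> set qs = states A \<and>
     (\<exists>i ts. i < length qs \<and> qs ! i = initial A \<and> distinct ts \<and>
        set ts = {(i, k, x, j). i < length qs \<and> k < length ls \<and> j < length qs \<and>
                    (x, qs ! j) \<in> delta A (qs ! i) (ls ! k)} \<and>
        t = tree_of_list [tree_of_nat (length ls), tree_of_nat (length qs), tree_of_nat i,
              tree_of_list (map tree_of_transition ts)])"

end

theory Submission
  imports Defs
begin

text \<open>
  Let \<open>opt p\<close> be the best value reachable from state \<open>p\<close>. Along a run \<open>opt\<close> is decreasing, hence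
  eventually constant, say \<open>T\<close>, and the value \<open>v\<close> of the run is at most \<open>T\<close>. Replacing each weight
  by \<open>opt\<close> of the target state gives a safe automaton with value \<open>T\<close>. Replacing only those weights
  that are at least \<open>opt\<close> of the target state, by the overall maximum \<open>opt\<close> of the initial state,
  leaves the value \<open>v\<close> unchanged if \<open>v < T\<close> and raises it to the maximum if \<open>v = T\<close>; the result is
  live because every prefix of a word with \<open>v < T\<close> can be continued to reach at least \<open>T\<close>.
  Neither construction changes the transition structure.

  Whether \<open>opt p\<close> is at least a given weight is a Buechi (for \<open>LimSup\<close>) or co-Buechi (for
  \<open>LimInf\<close>) condition on a graph with a single player, decided by iterating a one-step
  predecessor operator. Functions on trees computable in polynomial time contain the basic tree operations and
  are closed under composition, case distinction, and folds over lists whose step increases the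
  accumulator by an amount that does not depend on it; everything is programmed with these.
\<close>

section \<open>Functions on trees computable in polynomial time\<close>

text \<open>On a sequence of finite range both limits are among its entries, so \<open>opt p\<close>
  is one of the weights of the automaton: it is found by testing each weight as a threshold, with a
  fixpoint computation per test. Cutting at \<open>opt\<close> of the target makes the new weight a
  function of a single transition; along a run this agrees from some point on with cutting at
  \<open>T\<close>, and neither limit sees the finitely many positions before. The obstacle is the
  cost model. With sharing, a program can double a tree in each step, so a fold whose step
  multiplies the size of its accumulator may leave polynomial time. Additive growth shapes all
  programs: addition is cut to a fixed number of digits, and each fixpoint iterate is rebuilt from
  the transition list, whose size bounds it whatever the previous iterate was. The same list counts
  the rounds, because the iterates are sets of sources of transitions. Weights are compared exactly,
  by cross multiplication, so binary arithmetic has to be programmed as well.\<close>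

text \<open>Variable 0 passes the argument and the result, variable 1 holds a stack that every such program
  leaves unchanged, all other variables are scratch. Bounding the size of the result as well is what
  makes the notion closed under composition in the unit-cost model.\<close>

definition ptime :: "(tree \<Rightarrow> tree) \<Rightarrow> bool" where
  "ptime f \<longleftrightarrow> (\<exists>P (p :: nat poly). \<forall>s. \<exists>n s'. exec P s n s' \<and> s' 0 = f (s 0) \<and> s' 1 = s 1 \<and>
     n + nodes (f (s 0)) \<le> poly p (nodes (s 0)))"

lemma ptimeI:
  assumes "\<And>s. \<exists>n s'. exec P s n s' \<and> s' 0 = f (s 0) \<and> s' 1 = s 1 \<and>
     n + nodes (f (s 0)) \<le> poly p (nodes (s 0))"
  shows "ptime f"
  using assms unfolding ptime_def by blast

lemma ptimeE:
  assumes "ptime f"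
  obtains P p where "\<And>s. \<exists>n s'. exec P s n s' \<and> s' 0 = f (s 0) \<and> s' 1 = s 1 \<and>
     n + nodes (f (s 0)) \<le> poly p (nodes (s 0))"
  using assms unfolding ptime_def by blast

text \<open>Natural coefficients are nonnegative; this is what allows one bound to be substituted
  into another.\<close>

lemma poly_nat_mono:
  fixes p :: "nat poly"
  assumes "x \<le> y"
  shows "poly p x \<le> poly p y"
  using assms by (induction p) (auto intro: add_mono mult_mono)

lemma ex_execI:
  "exec P s n s' \<Longrightarrow> Q n s' \<Longrightarrow> \<exists>n s'. exec P s n s' \<and> Q n s'"
  by blast

lemma nodes_pos [simp]: "0 < nodes t"
  by (cases t) auto

lemma nodes_left_le: "nodes (left t) \<le> nodes t"
  by (cases t) auto

lemma nodes_right_le: "nodes (right t) \<le> nodes t"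
  by (cases t) auto

lemma ptime_id: "ptime (\<lambda>x. x)"
proof (rule ptimeI)
  show "\<exists>n s'. exec Skip s n s' \<and> s' 0 = s 0 \<and> s' 1 = s 1 \<and>
     n + nodes (s 0) \<le> poly [:1, 1:] (nodes (s 0))" for s
    by (rule ex_execI[OF exec.Skip]) auto
qed

lemma ptime_Atom: "ptime (\<lambda>x. Atom)"
proof (rule ptimeI)
  show "\<exists>n s'. exec (Assign 0 Nil_Expr) s n s' \<and> s' 0 = Atom \<and> s' 1 = s 1 \<and>
     n + nodes Atom \<le> poly [:3:] (nodes (s 0))" for s
    by (rule ex_execI[OF exec.Assign]) auto
qed

lemma ptime_left0: "ptime left"
proof (rule ptimeI)
  show "\<exists>n s'. exec (Assign 0 (Hd_Expr (Var 0))) s n s' \<and> s' 0 = left (s 0) \<and> s' 1 = s 1 \<and>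
     n + nodes (left (s 0)) \<le> poly [:3, 1:] (nodes (s 0))" for s
    by (rule ex_execI[OF exec.Assign]) (auto simp: nodes_left_le)
qed

lemma ptime_right0: "ptime right"
proof (rule ptimeI)
  show "\<exists>n s'. exec (Assign 0 (Tl_Expr (Var 0))) s n s' \<and> s' 0 = right (s 0) \<and> s' 1 = s 1 \<and>
     n + nodes (right (s 0)) \<le> poly [:3, 1:] (nodes (s 0))" for s
    by (rule ex_execI[OF exec.Assign]) (auto simp: nodes_right_le)
qed

lemma ptime_comp:
  assumes "ptime f" "ptime g"
  shows "ptime (\<lambda>x. f (g x))"
proof -
  obtain F p where F: "\<And>s. \<exists>n s'. exec F s n s' \<and> s' 0 = f (s 0) \<and> s' 1 = s 1 \<and>
     n + nodes (f (s 0)) \<le> poly p (nodes (s 0))"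
    using assms(1) by (rule ptimeE) blast
  obtain G q where G: "\<And>s. \<exists>n s'. exec G s n s' \<and> s' 0 = g (s 0) \<and> s' 1 = s 1 \<and>
     n + nodes (g (s 0)) \<le> poly q (nodes (s 0))"
    using assms(2) by (rule ptimeE) blast
  show ?thesis
  proof (rule ptimeI)
    fix s
    obtain n s' where 1: "exec G s n s'" "s' 0 = g (s 0)" "s' 1 = s 1"
      "n + nodes (g (s 0)) \<le> poly q (nodes (s 0))"
      using G by blast
    obtain m s'' where 2: "exec F s' m s''" "s'' 0 = f (s' 0)" "s'' 1 = s' 1"
      "m + nodes (f (s' 0)) \<le> poly p (nodes (s' 0))"
      using F by blast
    have "poly p (nodes (s' 0)) \<le> poly p (poly q (nodes (s 0)))"
      using 1 by (intro poly_nat_mono) simp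
    then show "\<exists>n s'. exec (Seq G F) s n s' \<and> s' 0 = f (g (s 0)) \<and> s' 1 = s 1 \<and>
        n + nodes (f (g (s 0))) \<le> poly (q + pcompose p q) (nodes (s 0))"
      using 1 2 by (intro exI[of _ "n + m"] exI[of _ s'']) (auto intro: exec.Seq simp: poly_pcompose)
  qed
qed

lemma ptime_left: "ptime f \<Longrightarrow> ptime (\<lambda>x. left (f x))"
  by (rule ptime_comp[OF ptime_left0])

lemma ptime_right: "ptime f \<Longrightarrow> ptime (\<lambda>x. right (f x))"
  by (rule ptime_comp[OF ptime_right0])

lemma exec_AssignI:
  "n = 1 + expr_cost e \<Longrightarrow> s' = s(i := eval_expr e s) \<Longrightarrow> exec (Assign i e) s n s'"
  using exec.Assign by simp

text \<open>Both functions need the input, but \<open>F\<close> may overwrite every variable except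
  the stack. The input therefore waits on the stack in variable 1, where it is then exchanged for
  the first result.\<close>

lemma ptime_Cell:
  assumes "ptime f" "ptime g"
  shows "ptime (\<lambda>x. Cell (f x) (g x))"
proof -
  obtain F p where F: "\<And>s. \<exists>n s'. exec F s n s' \<and> s' 0 = f (s 0) \<and> s' 1 = s 1 \<and>
     n + nodes (f (s 0)) \<le> poly p (nodes (s 0))"
    using assms(1) by (rule ptimeE) blast
  obtain G q where G: "\<And>s. \<exists>n s'. exec G s n s' \<and> s' 0 = g (s 0) \<and> s' 1 = s 1 \<and>
     n + nodes (g (s 0)) \<le> poly q (nodes (s 0))"
    using assms(2) by (rule ptimeE) blast
  let ?push = "Assign 1 (Cons_Expr (Var 0) (Var 1))"
  let ?swap = "Seq (Assign 2 (Var 0)) (Seq (Assign 0 (Hd_Expr (Var 1)))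
    (Assign 1 (Cons_Expr (Var 2) (Tl_Expr (Var 1)))))"
  let ?pop = "Seq (Assign 0 (Cons_Expr (Hd_Expr (Var 1)) (Var 0))) (Assign 1 (Tl_Expr (Var 1)))"
  let ?P = "Seq ?push (Seq F (Seq ?swap (Seq G ?pop)))"
  show ?thesis
  proof (rule ptimeI)
    fix s :: store
    define s1 where "s1 = s(1 := Cell (s 0) (s 1))"
    obtain n s2 where 1: "exec F s1 n s2" "s2 0 = f (s1 0)" "s2 1 = s1 1"
      "n + nodes (f (s1 0)) \<le> poly p (nodes (s1 0))"
      using F by blast
    define s3 where "s3 = s2(2 := s2 0, 0 := s 0, 1 := Cell (s2 0) (s 1))"
    obtain m s4 where 2: "exec G s3 m s4" "s4 0 = g (s3 0)" "s4 1 = s3 1"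
      "m + nodes (g (s3 0)) \<le> poly q (nodes (s3 0))"
      using G by blast
    define s5 where "s5 = s4(0 := Cell (f (s 0)) (g (s 0)), 1 := s 1)"
    have e1: "exec ?push s 4 s1"
      by (rule exec_AssignI) (auto simp: s1_def)
    have e2: "exec ?swap s2 (2 + (3 + 5)) s3"
      by (rule exec.Seq[OF exec_AssignI exec.Seq[OF exec_AssignI exec_AssignI]])
        (use 1 in \<open>auto simp: s3_def s1_def\<close>)
    have e3: "exec ?pop s4 (5 + 3) s5"
      by (rule exec.Seq[OF exec_AssignI exec_AssignI])
        (use 1 2 in \<open>auto simp: s5_def s3_def s1_def fun_upd_twist\<close>)
    have "exec ?P s (4 + (n + ((2 + (3 + 5)) + (m + (5 + 3))))) s5"
      by (intro exec.Seq[OF e1] exec.Seq[OF 1(1)] exec.Seq[OF e2] exec.Seq[OF 2(1)] e3)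
    \<comment> \<open>The constant is \<open>4 + 10 + 8\<close> for push, swap and pop, and one node
      for the new cell.\<close>
    then show "\<exists>n s'. exec ?P s n s' \<and> s' 0 = Cell (f (s 0)) (g (s 0)) \<and> s' 1 = s 1 \<and>
        n + nodes (Cell (f (s 0)) (g (s 0))) \<le> poly (p + q + [:23:]) (nodes (s 0))"
      by (rule ex_execI) (use 1 2 in \<open>auto simp: s5_def s3_def s1_def\<close>)
  qed
qed

definition ifT :: "tree \<Rightarrow> tree \<Rightarrow> tree \<Rightarrow> tree" where
  "ifT c a b = (if c = Atom then b else a)"

lemma ptime_ifT:
  assumes "ptime c" "ptime f" "ptime g"
  shows "ptime (\<lambda>x. ifT (c x) (f x) (g x))"
proof -
  obtain C r where C: "\<And>s. \<exists>n s'. exec C s n s' \<and> s' 0 = c (s 0) \<and> s' 1 = s 1 \<and>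
     n + nodes (c (s 0)) \<le> poly r (nodes (s 0))"
    using assms(1) by (rule ptimeE) blast
  obtain F p where F: "\<And>s. \<exists>n s'. exec F s n s' \<and> s' 0 = f (s 0) \<and> s' 1 = s 1 \<and>
     n + nodes (f (s 0)) \<le> poly p (nodes (s 0))"
    using assms(2) by (rule ptimeE) blast
  obtain G q where G: "\<And>s. \<exists>n s'. exec G s n s' \<and> s' 0 = g (s 0) \<and> s' 1 = s 1 \<and>
     n + nodes (g (s 0)) \<le> poly q (nodes (s 0))"
    using assms(3) by (rule ptimeE) blast
  let ?push = "Assign 1 (Cons_Expr (Var 0) (Var 1))"
  let ?pop = "Seq (Assign 2 (Var 0)) (Seq (Assign 0 (Hd_Expr (Var 1))) (Assign 1 (Tl_Expr (Var 1))))"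
  let ?P = "Seq ?push (Seq C (Seq ?pop (Cond (Var 2) F G)))"
  show ?thesis
  proof (rule ptimeI)
    fix s :: store
    define s1 where "s1 = s(1 := Cell (s 0) (s 1))"
    obtain n s2 where 1: "exec C s1 n s2" "s2 0 = c (s1 0)" "s2 1 = s1 1"
      "n + nodes (c (s1 0)) \<le> poly r (nodes (s1 0))"
      using C by blast
    define s3 where "s3 = s2(2 := s2 0, 0 := s 0, 1 := s 1)"
    have e1: "exec ?push s 4 s1"
      by (rule exec_AssignI) (auto simp: s1_def)
    have e2: "exec ?pop s2 (2 + (3 + 3)) s3"
      by (rule exec.Seq[OF exec_AssignI exec.Seq[OF exec_AssignI exec_AssignI]])
        (use 1 in \<open>auto simp: s3_def s1_def\<close>)
    obtain m s4 where 2: "exec (Cond (Var 2) F G) s3 (2 + m) s4" "s4 1 = s 1"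
      "s4 0 = ifT (c (s 0)) (f (s 0)) (g (s 0))"
      "m + nodes (ifT (c (s 0)) (f (s 0)) (g (s 0))) \<le> poly (p + q) (nodes (s 0))"
    proof (cases "c (s 0) = Atom")
      case True
      obtain m s4 where 2: "exec G s3 m s4" "s4 0 = g (s3 0)" "s4 1 = s3 1"
        "m + nodes (g (s3 0)) \<le> poly q (nodes (s3 0))"
        using G by blast
      have "exec (Cond (Var 2) F G) s3 (1 + expr_cost (Var 2) + m) s4"
        using True 1 2 by (intro exec.CondFalse) (auto simp: s3_def s1_def)
      then show ?thesis
        using that[of m s4] 2 True by (auto simp: ifT_def s3_def)
    next
      case False
      obtain m s4 where 2: "exec F s3 m s4" "s4 0 = f (s3 0)" "s4 1 = s3 1"
        "m + nodes (f (s3 0)) \<le> poly p (nodes (s3 0))"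
        using F by blast
      have "exec (Cond (Var 2) F G) s3 (1 + expr_cost (Var 2) + m) s4"
        using False 1 2 by (intro exec.CondTrue) (auto simp: s3_def s1_def)
      then show ?thesis
        using that[of m s4] 2 False by (auto simp: ifT_def s3_def)
    qed
    have "exec ?P s (4 + (n + ((2 + (3 + 3)) + (2 + m)))) s4"
      by (intro exec.Seq[OF e1] exec.Seq[OF 1(1)] exec.Seq[OF e2] 2(1))
    then show "\<exists>n s'. exec ?P s n s' \<and> s' 0 = ifT (c (s 0)) (f (s 0)) (g (s 0)) \<and> s' 1 = s 1 \<and>
        n + nodes (ifT (c (s 0)) (f (s 0)) (g (s 0))) \<le> poly (p + q + r + [:14:]) (nodes (s 0))"
      by (rule ex_execI) (use 1 2 in \<open>auto simp: s1_def\<close>)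
  qed
qed

section \<open>Folds over lists as while loops\<close>

fun foldT :: "(tree \<Rightarrow> tree \<Rightarrow> tree) \<Rightarrow> tree \<Rightarrow> tree \<Rightarrow> tree" where
  "foldT f Atom a = a"
| "foldT f (Cell y ys) a = foldT f ys (f y a)"

fun lenT :: "tree \<Rightarrow> nat" where
  "lenT Atom = 0"
| "lenT (Cell y ys) = Suc (lenT ys)"

lemma lenT_le_nodes: "lenT t \<le> nodes t"
  by (induction t) auto

text \<open>Every element has fewer nodes than the list, so each step adds at most the same amount,
  whatever the accumulator has become: growth adds up instead of multiplying.\<close>

lemma nodes_foldT_le:
  assumes "\<And>y a. nodes (f y a) \<le> nodes a + poly r (N + nodes y)" "nodes l \<le> N"
  shows "nodes (foldT f l a) \<le> nodes a + lenT l * poly r (N + N)"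
  using assms(2)
proof (induction l arbitrary: a)
  case (Cell y ys)
  have "nodes (foldT f (Cell y ys) a) \<le> nodes (f y a) + lenT ys * poly r (N + N)"
    using Cell by simp
  also have "nodes (f y a) \<le> nodes a + poly r (N + nodes y)"
    by (rule assms)
  also have "poly r (N + nodes y) \<le> poly r (N + N)"
    using Cell.prems by (intro poly_nat_mono) simp
  finally show ?case by simp
qed simp

text \<open>The loop state is \<open>Cell x (Cell l a)\<close>. The bound by \<open>K\<close>
  reserves in advance, for each remaining element, the growth it may cause; hence it is preserved
  while \<open>l\<close> shrinks and \<open>a\<close> grows, and every iteration costs at most
  \<open>poly q K\<close>.\<close>

lemma exec_loop:
  assumes G: "\<And>s. \<exists>n s'. exec G s n s' \<and> s' 0 = g (s 0) \<and> s' 1 = s 1 \<and>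
      n + nodes (g (s 0)) \<le> poly q (nodes (s 0))"
    and g: "\<And>x y ys a. g (Cell x (Cell (Cell y ys) a)) = Cell x (Cell ys (b x y a))"
    and grow: "\<And>y a. nodes (b x y a) \<le> nodes a + poly r (N + nodes y)"
    and "nodes l \<le> N"
    and "nodes x + 2 * nodes l + nodes a + lenT l * poly r (N + N) + 2 \<le> K"
    and "s 0 = Cell x (Cell l a)"
  shows "\<exists>n s'. exec (While (Hd_Expr (Tl_Expr (Var 0))) G) s n s' \<and>
    s' 0 = Cell x (Cell Atom (foldT (b x) l a)) \<and> s' 1 = s 1 \<and> n \<le> 4 + lenT l * (4 + poly q K)"
  using assms(4-6)
proof (induction l arbitrary: a s)
  case Atom
  then show ?case
    by (intro ex_execI[OF exec.WhileFalse]) auto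
next
  case (Cell y ys)
  obtain n s' where 1: "exec G s n s'" "s' 0 = g (s 0)" "s' 1 = s 1"
    "n + nodes (g (s 0)) \<le> poly q (nodes (s 0))"
    using G by blast
  have "poly r (N + nodes y) \<le> poly r (N + N)"
    using Cell.prems by (intro poly_nat_mono) simp
  then have ny: "nodes (b x y a) \<le> nodes a + poly r (N + N)"
    using grow[of y a] by linarith
  have "\<exists>n s''. exec (While (Hd_Expr (Tl_Expr (Var 0))) G) s' n s'' \<and>
    s'' 0 = Cell x (Cell Atom (foldT (b x) ys (b x y a))) \<and> s'' 1 = s' 1 \<and>
      n \<le> 4 + lenT ys * (4 + poly q K)"
  proof (rule Cell.IH)
    show "nodes ys \<le> N" "s' 0 = Cell x (Cell ys (b x y a))"
      using Cell.prems 1 g by auto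
    show "nodes x + 2 * nodes ys + nodes (b x y a) + lenT ys * poly r (N + N) + 2 \<le> K"
      using Cell.prems ny by simp
  qed
  then obtain m s'' where 2: "exec (While (Hd_Expr (Tl_Expr (Var 0))) G) s' m s''"
    "s'' 0 = Cell x (Cell Atom (foldT (b x) ys (b x y a)))" "s'' 1 = s' 1"
    "m \<le> 4 + lenT ys * (4 + poly q K)"
    by blast
  have e: "exec (While (Hd_Expr (Tl_Expr (Var 0))) G) s
      (1 + expr_cost (Hd_Expr (Tl_Expr (Var 0))) + n + m) s''"
    using Cell.prems by (intro exec.WhileTrue[OF _ 1(1) 2(1)]) simp
  have "poly q (nodes (s 0)) \<le> poly q K"
    using Cell.prems by (intro poly_nat_mono) simp
  with 1 2 show ?case
    by (intro ex_execI[OF e]) auto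
qed

text \<open>Programs take one argument, so the step receives its three packed as
  \<open>Cell x (Cell y a)\<close>. The original input \<open>x\<close> stays available in every
  iteration, which lets the step depend on it.\<close>

lemma ptime_foldT:
  assumes b: "ptime (\<lambda>z. b (left z) (left (right z)) (right (right z)))"
    and l: "ptime l" and a: "ptime a"
    and grow: "\<And>x y a. nodes (b x y a) \<le> nodes a + poly r (nodes x + nodes y)"
  shows "ptime (\<lambda>x. foldT (b x) (l x) (a x))"
proof -
  define g where "g z = Cell (left z) (Cell (right (left (right z)))
      (b (left z) (left (left (right z))) (right (right z))))" for z
  have "ptime (\<lambda>z. Cell (left z) (Cell (left (left (right z))) (right (right z))))"
    by (intro ptime_Cell ptime_left ptime_right ptime_id)
  from ptime_comp[OF b this]
  have "ptime (\<lambda>z. b (left z) (left (left (right z))) (right (right z)))"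
    by simp
  then have "ptime g"
    unfolding g_def by (intro ptime_Cell ptime_left ptime_right ptime_id)
  then obtain G q where G: "\<And>s. \<exists>n s'. exec G s n s' \<and> s' 0 = g (s 0) \<and> s' 1 = s 1 \<and>
     n + nodes (g (s 0)) \<le> poly q (nodes (s 0))"
    by (rule ptimeE) blast
  have "ptime (\<lambda>x. Cell x (Cell (l x) (a x)))"
    by (intro ptime_Cell ptime_id l a)
  then obtain I p where I: "\<And>s. \<exists>n s'. exec I s n s' \<and> s' 0 = Cell (s 0) (Cell (l (s 0)) (a (s 0))) \<and>
     s' 1 = s 1 \<and> n + nodes (Cell (s 0) (Cell (l (s 0)) (a (s 0)))) \<le> poly p (nodes (s 0))"
    by (rule ptimeE) blast
  let ?L = "While (Hd_Expr (Tl_Expr (Var 0))) G"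
  let ?out = "Assign 0 (Tl_Expr (Tl_Expr (Var 0)))"
  let ?P = "Seq I (Seq ?L ?out)"
  \<comment> \<open>\<open>R\<close> bounds the growth in one step, since both the input and an
    element have size at most \<open>p\<close>; \<open>K\<close> bounds the loop state.\<close>
  define R where "R = pcompose r (p + p)"
  define K where "K = p + p + p * R"
  have "ptime (\<lambda>x. foldT (b x) (l x) (a x))"
  proof (rule ptimeI)
    fix s :: store
    obtain n s1 where 1: "exec I s n s1" "s1 0 = Cell (s 0) (Cell (l (s 0)) (a (s 0)))" "s1 1 = s 1"
      "n + nodes (Cell (s 0) (Cell (l (s 0)) (a (s 0)))) \<le> poly p (nodes (s 0))"
      using I by blast
    let ?p = "poly p (nodes (s 0))"
    let ?l = "l (s 0)" and ?a = "a (s 0)"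
    have grow': "nodes (b (s 0) y a) \<le> nodes a + poly r (?p + nodes y)" for y a
      using grow[of "s 0" y a] poly_nat_mono[of "nodes (s 0) + nodes y" "?p + nodes y" r] 1 by simp
    have l_le: "nodes ?l \<le> ?p" and len_le: "lenT ?l \<le> ?p"
      using 1 lenT_le_nodes[of ?l] by auto
    have R: "poly r (?p + ?p) = poly R (nodes (s 0))"
      by (simp add: R_def poly_pcompose)
    have lenR: "lenT ?l * poly r (?p + ?p) \<le> ?p * poly R (nodes (s 0))"
      using len_le by (simp add: R)
    have "\<exists>n s'. exec ?L s1 n s' \<and> s' 0 = Cell (s 0) (Cell Atom (foldT (b (s 0)) ?l ?a)) \<and>
      s' 1 = s1 1 \<and> n \<le> 4 + lenT ?l * (4 + poly q (poly K (nodes (s 0))))"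
    proof (rule exec_loop[where b = b and g = g and N = ?p and r = r and q = q])
      show "g (Cell x (Cell (Cell y ys) a)) = Cell x (Cell ys (b x y a))" for x y ys a
        by (simp add: g_def)
      show "nodes (s 0) + 2 * nodes ?l + nodes ?a + lenT ?l * poly r (?p + ?p) + 2
          \<le> poly K (nodes (s 0))"
        using 1 lenR by (simp add: K_def)
    qed (use G grow' l_le 1 in auto)
    then obtain m s2 where 2: "exec ?L s1 m s2"
      "s2 0 = Cell (s 0) (Cell Atom (foldT (b (s 0)) ?l ?a))" "s2 1 = s1 1"
      "m \<le> 4 + lenT ?l * (4 + poly q (poly K (nodes (s 0))))"
      by blast
    have e: "exec ?P s (n + (m + 4)) (s2(0 := foldT (b (s 0)) ?l ?a))"
      by (intro exec.Seq[OF 1(1)] exec.Seq[OF 2(1)] exec_AssignI) (use 2 in auto)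
    have "m \<le> 4 + ?p * (4 + poly q (poly K (nodes (s 0))))"
      using 2(4) len_le by (meson add_left_mono le_trans mult_le_mono1)
    moreover have "nodes (foldT (b (s 0)) ?l ?a) \<le> ?p + ?p * poly R (nodes (s 0))"
      using nodes_foldT_le[where f = "b (s 0)", OF grow' l_le, of ?a] lenR 1 by simp
    ultimately show "\<exists>n s'. exec ?P s n s' \<and> s' 0 = foldT (b (s 0)) ?l ?a \<and> s' 1 = s 1 \<and>
        n + nodes (foldT (b (s 0)) ?l ?a)
          \<le> poly ([:8:] + p + p * ([:4:] + pcompose q K) + p + p * R) (nodes (s 0))"
      using 1 2 by (intro ex_execI[OF e]) (auto simp: poly_pcompose)
  qed
  then show ?thesis .
qed

lemma ptime_nodes_le:
  assumes "ptime f"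
  obtains p :: "nat poly" where "\<And>x. nodes (f x) \<le> poly p (nodes x)"
proof -
  obtain P p where P: "\<And>s. \<exists>n s'. exec P s n s' \<and> s' 0 = f (s 0) \<and> s' 1 = s 1 \<and>
     n + nodes (f (s 0)) \<le> poly p (nodes (s 0))"
    using assms by (rule ptimeE) blast
  have "nodes (f x) \<le> poly p (nodes x)" for x
    using P[of "\<lambda>_. x"] by auto
  then show ?thesis by (rule that)
qed

text \<open>The extra node in each step is paid for by the list cell that holds the element.\<close>

lemma nodes_foldT_less:
  assumes "\<And>y a. nodes (f y a) \<le> nodes a + nodes y + 1"
  shows "nodes (foldT f l a) < nodes l + nodes a"
proof (induction l arbitrary: a)
  case (Cell y ys)
  show ?case
    using Cell(2)[of "f y a"] assms[of y a] by simp
qed simp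

lemma ptime_computes:
  assumes "ptime f"
  shows "\<exists>P p. \<forall>t. computes_within P t (poly p (nodes t)) (f t)"
proof -
  obtain P p where P: "\<And>s. \<exists>n s'. exec P s n s' \<and> s' 0 = f (s 0) \<and> s' 1 = s 1 \<and>
     n + nodes (f (s 0)) \<le> poly p (nodes (s 0))"
    using assms by (rule ptimeE) blast
  have "computes_within P t (poly p (nodes t)) (f t)" for t
    using P[of "(\<lambda>_. Atom)(0 := t)"] by (auto simp: computes_within_def)
  then show ?thesis by blast
qed

section \<open>Binary arithmetic on trees\<close>

abbreviation trueT :: tree where
  "trueT \<equiv> Cell Atom Atom"

lemma ptime_True: "ptime (\<lambda>x. trueT)"
  by (intro ptime_Cell ptime_Atom)

lemma nodes_ifT_le: "nodes (ifT c a b) \<le> max (nodes a) (nodes b)"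
  by (simp add: ifT_def)

text \<open>Any tree other than the atom counts as digit one, and leading zeros are allowed, because
  intermediate results are not in the normal form of \<open>bits\<close>.\<close>

fun val :: "tree \<Rightarrow> nat" where
  "val Atom = 0"
| "val (Cell b t) = of_bool (b \<noteq> Atom) + 2 * val t"

lemma val_rec: "val t = of_bool (left t \<noteq> Atom) + 2 * val (right t)"
  by (cases t) auto

lemma val_less: "val t < 2 ^ lenT t"
  by (induction t) auto

definition anyT :: "tree \<Rightarrow> tree" where
  "anyT ys = foldT (\<lambda>y a. ifT y trueT a) ys Atom"

lemma anyT_iff: "anyT ys \<noteq> Atom \<longleftrightarrow> val ys \<noteq> 0"
proof -
  have "foldT (\<lambda>y a. ifT y trueT a) ys a \<noteq> Atom \<longleftrightarrow> val ys \<noteq> 0 \<or> a \<noteq> Atom" for a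
    by (induction ys arbitrary: a) (auto simp: ifT_def)
  then show ?thesis by (simp add: anyT_def)
qed

lemma ptime_anyT: "ptime f \<Longrightarrow> ptime (\<lambda>x. anyT (f x))"
  unfolding anyT_def
proof (rule ptime_foldT[where r = "[:3:]"])
  show "nodes (ifT y trueT a) \<le> nodes a + poly [:3:] (nodes x + nodes y)" for x y a
    using nodes_ifT_le[of y trueT a] by simp
qed (intro ptime_ifT ptime_True ptime_Atom ptime_left ptime_right ptime_id | assumption)+

text \<open>Digits come least significant first, so a later digit overrides the verdict on earlier
  ones. The accumulator pairs the unread digits of the second number with the verdict so far; an
  exhausted number reads as zeros.\<close>

definition cmp_stepT :: "tree \<Rightarrow> tree \<Rightarrow> tree" where
  "cmp_stepT x p = Cell (right (left p))
     (ifT (left (left p)) (ifT x (right p) trueT) (ifT x Atom (right p)))"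

definition cmp_resT :: "tree \<Rightarrow> tree" where
  "cmp_resT p = ifT (anyT (left p)) trueT (right p)"

definition leT :: "tree \<Rightarrow> tree \<Rightarrow> tree" where
  "leT xs ys = cmp_resT (foldT cmp_stepT xs (Cell ys trueT))"

lemma leT_iff: "leT xs ys \<noteq> Atom \<longleftrightarrow> val xs \<le> val ys"
proof -
  have "cmp_resT (foldT cmp_stepT xs (Cell ys r)) \<noteq> Atom \<longleftrightarrow>
      val xs < val ys \<or> val xs = val ys \<and> r \<noteq> Atom" for r
  proof (induction xs arbitrary: ys r)
    case Atom
    show ?case
      using anyT_iff[of ys] by (auto simp: cmp_resT_def ifT_def)
  next
    case (Cell x xs)
    show ?case
      using val_rec[of ys] Cell(2) by (auto simp: cmp_stepT_def ifT_def of_bool_def)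
  qed
  then show ?thesis by (auto simp: leT_def)
qed

lemma ptime_leT:
  assumes "ptime f" "ptime g"
  shows "ptime (\<lambda>x. leT (f x) (g x))"
proof -
  have "ptime (\<lambda>x. foldT cmp_stepT (f x) (Cell (g x) trueT))"
  proof (rule ptime_foldT[where r = "[:5:]"])
    show "nodes (cmp_stepT y p) \<le> nodes p + poly [:5:] (nodes x + nodes y)" for x y p
      using nodes_right_le[of "left p"] by (cases p) (auto simp: cmp_stepT_def ifT_def)
    show "ptime (\<lambda>z. cmp_stepT (left (right z)) (right (right z)))"
      unfolding cmp_stepT_def
      by (intro ptime_Cell ptime_ifT ptime_True ptime_Atom ptime_left ptime_right ptime_id)
  qed (intro ptime_Cell ptime_True assms)+
  then show ?thesis
    unfolding leT_def cmp_resT_def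
    by (intro ptime_ifT ptime_anyT ptime_left ptime_right ptime_True)
qed

section \<open>Reversal, addition and multiplication\<close>

definition revT :: "tree \<Rightarrow> tree \<Rightarrow> tree" where
  "revT xs ys = foldT Cell xs ys"

lemma revT_simps [simp]:
  "revT Atom ys = ys"
  "revT (Cell x xs) ys = revT xs (Cell x ys)"
  by (simp_all add: revT_def)

lemma lenT_revT [simp]: "lenT (revT xs ys) = lenT xs + lenT ys"
  by (induction xs arbitrary: ys) auto

lemma nodes_revT: "nodes (revT xs ys) \<le> nodes xs + nodes ys"
proof (induction xs arbitrary: ys)
  case (Cell x xs)
  show ?case
    using Cell(2)[of "Cell x ys"] by simp
qed simp

lemma val_revT: "val (revT xs ys) = val (revT xs Atom) + 2 ^ lenT xs * val ys"
proof (induction xs arbitrary: ys)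
  case (Cell x xs)
  show ?case
    by (simp add: Cell(2)[of "Cell x ys"] Cell(2)[of "Cell x Atom"] algebra_simps)
qed simp

lemma revT_revT: "revT (revT xs ys) zs = revT ys (revT (revT xs Atom) zs)"
proof (induction xs arbitrary: ys zs)
  case (Cell x xs)
  show ?case
    by (simp add: Cell(2)[of "Cell x ys"] Cell(2)[of "Cell x Atom"])
qed simp

fun appT :: "tree \<Rightarrow> tree \<Rightarrow> tree" where
  "appT Atom ys = ys"
| "appT (Cell x xs) ys = Cell x (appT xs ys)"

lemma revT_revT_Atom: "revT (revT xs Atom) ys = appT xs ys"
proof (induction xs arbitrary: ys)
  case (Cell x xs)
  then show ?case by (simp add: revT_revT[of xs "Cell x Atom"])
qed simp

lemma appT_Atom_val [simp]: "val (appT xs Atom) = val xs"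
  by (induction xs) auto

lemma ptime_revT:
  assumes "ptime f" "ptime g"
  shows "ptime (\<lambda>x. revT (f x) (g x))"
  unfolding revT_def
proof (rule ptime_foldT[where r = "[:1, 1:]"])
  show "nodes (Cell y a) \<le> nodes a + poly [:1, 1:] (nodes x + nodes y)" for x y a
    by simp
qed (intro ptime_Cell ptime_left ptime_right ptime_id assms)+

text \<open>A full adder: the new carry is the majority of three digits, the output digit their
  exclusive or. The state holds the unread digits of both numbers, the carry, and the output with
  its most significant digit in front.\<close>

definition add_stepT :: "tree \<Rightarrow> tree" where
  "add_stepT p = (let x = left (left (left p)); y = left (right (left p)); c = left (right p) in
     Cell (Cell (right (left (left p))) (right (right (left p))))
       (Cell (ifT x (ifT y trueT c) (ifT y c Atom))
         (Cell (ifT (ifT x (ifT y Atom trueT) y) (ifT c Atom trueT) (ifT c trueT Atom))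
           (right (right p)))))"

text \<open>Addition modulo \<open>2 ^ lenT d\<close>: the fixed number of digits keeps the accumulator of
  \<open>mulT\<close> polynomially bounded.\<close>

definition addT :: "tree \<Rightarrow> tree \<Rightarrow> tree \<Rightarrow> tree" where
  "addT d xs ys = revT (right (right
     (foldT (\<lambda>_. add_stepT) d (Cell (Cell xs ys) (Cell Atom Atom))))) Atom"

lemma add_stepT_simp:
  "\<exists>c' b. add_stepT (Cell (Cell xs ys) (Cell c out)) =
      Cell (Cell (right xs) (right ys)) (Cell c' (Cell b out)) \<and>
    val xs + val ys + of_bool (c \<noteq> Atom) =
      of_bool (b \<noteq> Atom) + 2 * (val (right xs) + val (right ys) + of_bool (c' \<noteq> Atom)) \<and>
    nodes b \<le> 3"
  using val_rec[of xs] val_rec[of ys] by (auto simp: add_stepT_def Let_def ifT_def)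

text \<open>Growth must be bounded for every tree \<open>p\<close>, including malformed states in
  which \<open>left\<close> and \<open>right\<close> meet an atom.\<close>

lemma nodes_add_stepT: "nodes (add_stepT p) \<le> nodes p + 12"
proof -
  define x y c where "x = left (left (left p))" and "y = left (right (left p))" and "c = left (right p)"
  have "nodes (ifT x (ifT y trueT c) (ifT y c Atom)) \<le> nodes c + 2"
    by (cases c) (auto simp: ifT_def)
  moreover have "nodes (ifT (ifT x (ifT y Atom trueT) y) (ifT c Atom trueT) (ifT c trueT Atom)) \<le> 3"
    by (auto simp: ifT_def)
  moreover have "nodes (right (left (left p))) + nodes (right (right (left p))) + nodes c
      + nodes (right (right p)) \<le> nodes p + 3"
  proof (cases p)
    case (Cell l r)
    have "nodes (right (left l)) + nodes (right (right l)) \<le> nodes l + 1"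
      using nodes_right_le[of "left l"] nodes_right_le[of "right l"] by (cases l) auto
    moreover have "nodes c + nodes (right r) \<le> nodes r + 1"
      using Cell by (cases r) (auto simp: c_def)
    ultimately show ?thesis
      using Cell by simp
  qed (simp add: c_def)
  ultimately show ?thesis
    by (simp add: add_stepT_def Let_def flip: x_def y_def c_def)
qed

text \<open>Carry and output are arbitrary for the sake of the induction. The list \<open>d\<close>
  only counts digits, and dropping the last carry produces the modulus. The size bound depends on
  neither summand, which is what multiplication relies on.\<close>

lemma foldT_add_stepT:
  defines "F \<equiv> \<lambda>d xs ys c out. right (right (foldT (\<lambda>_. add_stepT) d (Cell (Cell xs ys) (Cell c out))))"
  shows "val (revT (F d xs ys c out) Atom) = val (revT out Atom) +
      2 ^ lenT out * ((val xs + val ys + of_bool (c \<noteq> Atom)) mod 2 ^ lenT d) \<and>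
    nodes (F d xs ys c out) \<le> 4 * lenT d + nodes out"
proof (induction d arbitrary: xs ys c out)
  case (Cell y d)
  obtain c' b where st: "add_stepT (Cell (Cell xs ys) (Cell c out)) =
      Cell (Cell (right xs) (right ys)) (Cell c' (Cell b out))"
    and v: "val xs + val ys + of_bool (c \<noteq> Atom) =
      of_bool (b \<noteq> Atom) + 2 * (val (right xs) + val (right ys) + of_bool (c' \<noteq> Atom))"
    and b: "nodes b \<le> 3"
    using add_stepT_simp by blast
  let ?S = "val (right xs) + val (right ys) + of_bool (c' \<noteq> Atom)"
  have F: "F (Cell y d) xs ys c out = F d (right xs) (right ys) c' (Cell b out)"
    by (simp add: F_def st)
  have md: "(of_bool B + 2 * S) mod 2 ^ Suc n = of_bool B + 2 * (S mod 2 ^ n)" for B and S n :: nat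
    by (cases B) (simp_all add: mod_mult2_eq)
  have "val (revT (F (Cell y d) xs ys c out) Atom) =
      val (revT out (Cell b Atom)) + 2 * 2 ^ lenT out * (?S mod 2 ^ lenT d)"
    using Cell(2)[of "right xs" "right ys" c' "Cell b out"] by (simp add: F)
  also have "val (revT out (Cell b Atom)) = val (revT out Atom) + 2 ^ lenT out * of_bool (b \<noteq> Atom)"
    using val_revT[of out "Cell b Atom"] by simp
  also have "\<dots> + 2 * 2 ^ lenT out * (?S mod 2 ^ lenT d) =
      val (revT out Atom) + 2 ^ lenT out * (of_bool (b \<noteq> Atom) + 2 * (?S mod 2 ^ lenT d))"
    by (simp only: distrib_left mult.assoc mult.left_commute add.assoc)
  finally have 1: "val (revT (F (Cell y d) xs ys c out) Atom) = val (revT out Atom) +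
      2 ^ lenT out * ((val xs + val ys + of_bool (c \<noteq> Atom)) mod 2 ^ lenT (Cell y d))"
    by (simp only: lenT.simps v md)
  moreover have "nodes (F (Cell y d) xs ys c out) \<le> 4 * lenT (Cell y d) + nodes out"
    using Cell(2)[of "right xs" "right ys" c' "Cell b out"] b by (simp add: F)
  ultimately show ?case ..
qed (simp add: F_def)

lemma val_addT: "val (addT d xs ys) = (val xs + val ys) mod 2 ^ lenT d"
  unfolding addT_def by (simp add: foldT_add_stepT)

lemma nodes_addT: "nodes (addT d xs ys) \<le> 4 * nodes d + 2"
proof -
  have "nodes (addT d xs ys) \<le> 4 * lenT d + 2"
    unfolding addT_def
    by (rule order_trans[OF nodes_revT]) (use foldT_add_stepT[of d xs ys Atom Atom] in simp)
  then show ?thesis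
    using lenT_le_nodes[of d] by simp
qed

lemma ptime_addT:
  assumes "ptime d" "ptime f" "ptime g"
  shows "ptime (\<lambda>x. addT (d x) (f x) (g x))"
proof -
  have "ptime (\<lambda>x. foldT (\<lambda>_. add_stepT) (d x) (Cell (Cell (f x) (g x)) (Cell Atom Atom)))"
  proof (rule ptime_foldT[where r = "[:12:]"])
    show "nodes (add_stepT p) \<le> nodes p + poly [:12:] (nodes x + nodes y)" for x y p
      by (simp add: nodes_add_stepT)
    show "ptime (\<lambda>z. add_stepT (right (right z)))"
      unfolding add_stepT_def Let_def
      by (intro ptime_Cell ptime_ifT ptime_True ptime_Atom ptime_left ptime_right ptime_id)
  qed (intro ptime_Cell ptime_Atom assms)+
  then show ?thesis
    unfolding addT_def by (intro ptime_revT ptime_right ptime_Atom)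
qed

text \<open>Horner's scheme from the most significant digit of \<open>b\<close>, where
  \<open>Cell Atom acc\<close> doubles \<open>acc\<close>. Only the length of
  \<open>revT a b\<close> matters: the two lengths together are enough digits for the
  product.\<close>

definition mulT :: "tree \<Rightarrow> tree \<Rightarrow> tree" where
  "mulT a b = foldT (\<lambda>x acc. addT (revT a b) (Cell Atom acc) (ifT x a Atom)) (revT b Atom) Atom"

text \<open>Doubling and adding respect congruence modulo \<open>M\<close>, so truncating in every
  step is harmless: the final result and the true product are both below \<open>M\<close>.\<close>

lemma val_mulT: "val (mulT a b) = val a * val b"
proof -
  define M where "M = (2 :: nat) ^ lenT (revT a b)"
  define h where "h = (\<lambda>x acc. addT (revT a b) (Cell Atom acc) (ifT x a Atom))"
  have h: "val (h x acc) = (2 * val acc + of_bool (x \<noteq> Atom) * val a) mod M" for x acc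
    by (simp add: h_def val_addT M_def ifT_def)
  have 1: "val (foldT h l acc) mod M = (val acc * 2 ^ lenT l + val (revT l Atom) * val a) mod M" for l acc
  proof (induction l arbitrary: acc)
    case (Cell x l)
    have "val (foldT h (Cell x l) acc) mod M =
        ((2 * val acc + of_bool (x \<noteq> Atom) * val a) mod M * 2 ^ lenT l + val (revT l Atom) * val a) mod M"
      by (simp add: Cell h)
    also have "\<dots> = ((2 * val acc + of_bool (x \<noteq> Atom) * val a) * 2 ^ lenT l + val (revT l Atom) * val a) mod M"
      by (metis mod_add_left_eq mod_mult_left_eq)
    also have "(2 * val acc + of_bool (x \<noteq> Atom) * val a) * 2 ^ lenT l + val (revT l Atom) * val a =
        val acc * 2 ^ lenT (Cell x l) + val (revT (Cell x l) Atom) * val a"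
      using val_revT[of l "Cell x Atom"] by (simp add: algebra_simps)
    finally show ?case .
  qed simp
  have 2: "val acc < M \<Longrightarrow> val (foldT h l acc) < M" for l acc
    by (induction l arbitrary: acc) (auto simp: h M_def)
  have "val (mulT a b) = val (foldT h (revT b Atom) Atom)"
    by (simp add: mulT_def h_def)
  also have "\<dots> = val (foldT h (revT b Atom) Atom) mod M"
    using 2[of Atom] by (simp add: M_def)
  also have "\<dots> = (val a * val b) mod M"
    by (simp add: 1 revT_revT_Atom mult.commute)
  also have "val a * val b < M"
    unfolding M_def lenT_revT power_add
    by (intro mult_strict_mono') (auto simp: val_less)
  then have "(val a * val b) mod M = val a * val b"
    by simp
  finally show ?thesis .
qed

lemma ptime_mulT:
  assumes "ptime f" "ptime g"
  shows "ptime (\<lambda>x. mulT (f x) (g x))"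
proof -
  have "ptime (\<lambda>z. mulT (left z) (right z))"
    unfolding mulT_def
  \<comment> \<open>The result of \<open>addT\<close> is bounded through its digit counter alone,
    which here has at most \<open>2 * nodes x\<close> nodes.\<close>
  proof (rule ptime_foldT[where r = "[:2, 8:]"])
    show "nodes (addT (revT (left x) (right x)) (Cell Atom acc) (ifT y (left x) Atom))
        \<le> nodes acc + poly [:2, 8:] (nodes x + nodes y)" for x y acc
    proof -
      have "nodes (revT (left x) (right x)) \<le> 2 * nodes x"
        using nodes_revT[of "left x" "right x"] nodes_left_le[of x] nodes_right_le[of x] by simp
      then show ?thesis
        using nodes_addT[of "revT (left x) (right x)" "Cell Atom acc" "ifT y (left x) Atom"] by simp
    qed
  qed (intro ptime_addT ptime_revT ptime_Cell ptime_ifT ptime_Atom ptime_left ptime_right ptime_id)+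
  from ptime_comp[OF this ptime_Cell[OF assms]] show ?thesis
    by simp
qed

text \<open>The tree of a rational holds sign and absolute value of the numerator, then the positive
  denominator. For two negative numbers the comparison of the cross products is reversed.\<close>

definition leQ :: "tree \<Rightarrow> tree \<Rightarrow> tree" where
  "leQ x y = ifT (left (left x))
     (ifT (left (left y)) (leT (mulT (right (left y)) (right x)) (mulT (right (left x)) (right y))) trueT)
     (ifT (left (left y)) Atom (leT (mulT (right (left x)) (right y)) (mulT (right (left y)) (right x))))"

lemma ptime_leQ: "ptime f \<Longrightarrow> ptime g \<Longrightarrow> ptime (\<lambda>x. leQ (f x) (g x))"
  unfolding leQ_def
  by (intro ptime_ifT ptime_leT ptime_mulT ptime_True ptime_Atom ptime_left ptime_right)

lemma val_tree_of_nat: "val (tree_of_nat n) = n"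
proof (induction n rule: bits.induct)
  case (1 n)
  then show ?case
    by (subst tree_of_nat_def, subst bits.simps)
      (auto simp: tree_of_bool_def simp flip: tree_of_nat_def)
qed

lemma leQ_iff: "leQ (tree_of_rat x) (tree_of_rat y) \<noteq> Atom \<longleftrightarrow> x \<le> y"
proof -
  obtain a b where x: "quotient_of x = (a, b)" by (cases "quotient_of x")
  obtain c d where y: "quotient_of y = (c, d)" by (cases "quotient_of y")
  have pos: "b > 0" "d > 0"
    using quotient_of_denom_pos[OF x] quotient_of_denom_pos[OF y] by auto
  have "x \<le> y \<longleftrightarrow> rat_of_int a * of_int d \<le> of_int c * of_int b"
    using pos by (simp add: quotient_of_div[OF x] quotient_of_div[OF y] divide_simps mult.commute)
  also have "\<dots> \<longleftrightarrow> a * d \<le> c * b"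
    by (simp only: of_int_mult[symmetric] of_int_le_iff)
  also have "\<dots> \<longleftrightarrow> leQ (tree_of_rat x) (tree_of_rat y) \<noteq> Atom"
  proof -
    have le: "leT (mulT (tree_of_nat (nat \<bar>a\<bar>)) (tree_of_nat (nat d)))
        (mulT (tree_of_nat (nat \<bar>c\<bar>)) (tree_of_nat (nat b))) \<noteq> Atom \<longleftrightarrow> \<bar>a\<bar> * d \<le> \<bar>c\<bar> * b"
      "leT (mulT (tree_of_nat (nat \<bar>c\<bar>)) (tree_of_nat (nat b)))
        (mulT (tree_of_nat (nat \<bar>a\<bar>)) (tree_of_nat (nat d))) \<noteq> Atom \<longleftrightarrow> \<bar>c\<bar> * b \<le> \<bar>a\<bar> * d"
      using pos by (auto simp: leT_iff val_mulT val_tree_of_nat nat_le_iff simp flip: nat_mult_distrib)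
    have signs: "a < 0 \<Longrightarrow> c \<ge> 0 \<Longrightarrow> a * d \<le> c * b" "a \<ge> 0 \<Longrightarrow> c < 0 \<Longrightarrow> \<not> a * d \<le> c * b"
      using pos mult_neg_pos[of a d] mult_neg_pos[of c b] mult_nonneg_nonneg[of a d]
        mult_nonneg_nonneg[of c b] by linarith+
    show ?thesis
      using le signs
      by (cases "a < 0"; cases "c < 0")
        (auto simp: leQ_def ifT_def tree_of_rat_def x y tree_of_int_def tree_of_bool_def)
  qed
  finally show ?thesis by simp
qed

definition eqT :: "tree \<Rightarrow> tree \<Rightarrow> tree" where
  "eqT a b = ifT (leT a b) (leT b a) Atom"

lemma eqT_iff: "eqT (tree_of_nat m) (tree_of_nat n) \<noteq> Atom \<longleftrightarrow> m = n"
  using leT_iff[of "tree_of_nat m" "tree_of_nat n"] leT_iff[of "tree_of_nat n" "tree_of_nat m"]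
  by (auto simp: eqT_def ifT_def val_tree_of_nat)

definition memT :: "tree \<Rightarrow> tree \<Rightarrow> tree" where
  "memT q l = foldT (\<lambda>y a. ifT (eqT q y) trueT a) l Atom"

lemma ptime_memT:
  assumes "ptime f" "ptime g"
  shows "ptime (\<lambda>x. memT (f x) (g x))"
  unfolding memT_def eqT_def
proof (rule ptime_foldT[where r = "[:3:]"])
  show "nodes (ifT (ifT (leT (f x) y) (leT y (f x)) Atom) trueT a) \<le> nodes a + poly [:3:] (nodes x + nodes y)"
    for x y a
    by (rule order_trans[OF nodes_ifT_le]) auto
  show "ptime (\<lambda>z. ifT (ifT (leT (f (left z)) (left (right z))) (leT (left (right z)) (f (left z))) Atom)
      trueT (right (right z)))"
    by (intro ptime_ifT ptime_leT ptime_comp[OF assms(1)] ptime_True ptime_Atom ptime_left ptime_right ptime_id)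
qed (intro assms ptime_Atom)+

lemma foldT_tree_of_list: "foldT f (tree_of_list ts) a = fold f ts a"
  by (induction ts arbitrary: a) auto

lemma memT_iff: "memT (tree_of_nat n) (tree_of_list (map tree_of_nat l)) \<noteq> Atom \<longleftrightarrow> n \<in> set l"
proof -
  have "fold (\<lambda>y a. ifT (eqT (tree_of_nat n) y) trueT a) (map tree_of_nat l) a \<noteq> Atom \<longleftrightarrow>
      n \<in> set l \<or> a \<noteq> Atom" for a
    using eqT_iff[of n] by (induction l arbitrary: a) (auto simp: ifT_def)
  then show ?thesis by (simp add: memT_def foldT_tree_of_list)
qed

section \<open>Fixpoint iteration on transition lists\<close>

abbreviation "srcT e \<equiv> left e"
abbreviation "letT e \<equiv> left (right e)"
abbreviation "wtT e \<equiv> left (right (right e))"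
abbreviation "tgtT e \<equiv> left (right (right (right e)))"

lemma nodes_proj_le:
  "nodes (srcT e) \<le> nodes e" "nodes (letT e) \<le> nodes e"
  "nodes (wtT e) \<le> nodes e" "nodes (tgtT e) \<le> nodes e"
  by (meson nodes_left_le nodes_right_le order_trans)+

lemmas ptime_intros = ptime_ifT ptime_Cell ptime_True ptime_Atom ptime_left ptime_right ptime_id
  ptime_leQ ptime_memT

definition stepT :: "tree \<Rightarrow> tree \<Rightarrow> tree \<Rightarrow> tree \<Rightarrow> tree" where
  "stepT ts x Y R = foldT (\<lambda>e a.
     ifT (ifT (ifT (leQ x (wtT e)) (memT (tgtT e) Y) Atom) trueT (memT (tgtT e) R))
       (Cell (srcT e) a) a) ts Atom"

text \<open>Each transition contributes at most its own source, whatever \<open>Y\<close> and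
  \<open>R\<close> are; repetitions in the result do no harm.\<close>

lemma nodes_stepT: "nodes (stepT ts x Y R) \<le> nodes ts"
proof -
  have "nodes (stepT ts x Y R) < nodes ts + nodes Atom"
    unfolding stepT_def
  proof (rule nodes_foldT_less)
    show "nodes (ifT c (Cell (srcT e) a) a) \<le> nodes a + nodes e + 1" for c e a
      using nodes_proj_le(1)[of e] by (auto simp: ifT_def)
  qed
  then show ?thesis by simp
qed

lemma ptime_stepT:
  assumes "ptime ts" "ptime x" "ptime Y" "ptime R"
  shows "ptime (\<lambda>z. stepT (ts z) (x z) (Y z) (R z))"
  unfolding stepT_def
proof (rule ptime_foldT[where r = "[:1, 1:]"])
  show "nodes (ifT (c z e) (Cell (srcT e) a) a) \<le> nodes a + poly [:1, 1:] (nodes z + nodes e)"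
    for c :: "tree \<Rightarrow> tree \<Rightarrow> tree" and z e a
    using nodes_proj_le(1)[of e] by (auto simp: ifT_def)
qed (intro ptime_intros assms assms[THEN ptime_comp])+

text \<open>Here \<open>ts\<close> also serves as a counter. It is long enough: the iterates consist
  of sources of transitions, and there are at most as many of these as transitions.\<close>

definition lfpT :: "tree \<Rightarrow> tree \<Rightarrow> tree \<Rightarrow> tree" where
  "lfpT ts x Y = foldT (\<lambda>_ R. stepT ts x Y R) ts Atom"

text \<open>A step whose result is bounded in terms of \<open>z\<close> alone replaces the
  accumulator rather than extending it, so its growth is additive.\<close>

lemma ptime_iterate:
  assumes "ptime ts" "ptime a" "ptime (\<lambda>z. g (left z) (right (right z)))"
    and "\<And>z a. nodes (g z a) \<le> nodes (ts z)"
  shows "ptime (\<lambda>z. foldT (\<lambda>_. g z) (ts z) (a z))"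
proof -
  obtain p :: "nat poly" where p: "\<And>z. nodes (ts z) \<le> poly p (nodes z)"
    using ptime_nodes_le[OF assms(1)] by blast
  show ?thesis
  proof (rule ptime_foldT[where r = p])
    show "nodes (g z a) \<le> nodes a + poly p (nodes z + nodes y)" for z y a
      using assms(4)[of z a] p[of z] poly_nat_mono[of "nodes z" "nodes z + nodes y" p] by simp
  qed (use assms in auto)
qed

lemma nodes_iterate:
  assumes "\<And>a. nodes (g a) \<le> N" "nodes a \<le> N"
  shows "nodes (foldT (\<lambda>_. g) l a) \<le> N"
  using assms by (induction l arbitrary: a) auto

lemma ptime_lfpT:
  assumes "ptime ts" "ptime x" "ptime Y"
  shows "ptime (\<lambda>z. lfpT (ts z) (x z) (Y z))"
  unfolding lfpT_def
  by (intro ptime_iterate ptime_stepT ptime_intros assms assms[THEN ptime_comp] nodes_stepT)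

lemma nodes_lfpT: "nodes (lfpT ts x Y) \<le> nodes ts"
  unfolding lfpT_def by (rule nodes_iterate) (auto simp: nodes_stepT Suc_leI)

definition allT :: "tree \<Rightarrow> tree" where
  "allT ts = foldT (\<lambda>e a. Cell (srcT e) a) ts Atom"

lemma ptime_allT:
  assumes "ptime ts"
  shows "ptime (\<lambda>z. allT (ts z))"
  unfolding allT_def
  by (rule ptime_foldT[where r = "[:1, 1:]"]) (intro ptime_intros assms | simp add: nodes_proj_le trans_le_add2)+

text \<open>Recurrence: the outer loop shrinks \<open>Y\<close> to the states from which a good edge
  into \<open>Y\<close> can be reached, over and over again.\<close>

definition winS_T :: "tree \<Rightarrow> tree \<Rightarrow> tree" where
  "winS_T ts x = foldT (\<lambda>_ Y. lfpT ts x Y) ts (allT ts)"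

text \<open>Persistence: with \<open>R\<close> empty the inner loop keeps the states that can follow
  good edges forever; the outer call adds what can reach them.\<close>

definition winI_T :: "tree \<Rightarrow> tree \<Rightarrow> tree" where
  "winI_T ts x = lfpT ts x (foldT (\<lambda>_ Y. stepT ts x Y Atom) ts (allT ts))"

lemma ptime_winS_T:
  assumes "ptime ts" "ptime x"
  shows "ptime (\<lambda>z. winS_T (ts z) (x z))"
  unfolding winS_T_def
  by (intro ptime_iterate ptime_lfpT ptime_allT ptime_intros assms assms[THEN ptime_comp] nodes_lfpT)

lemma ptime_winI_T:
  assumes "ptime ts" "ptime x"
  shows "ptime (\<lambda>z. winI_T (ts z) (x z))"
  unfolding winI_T_def
  by (intro ptime_lfpT assms ptime_iterate ptime_stepT ptime_allT ptime_intros
      assms[THEN ptime_comp] nodes_stepT)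

text \<open>The atom stands for the absence of a candidate; the tree of a rational is always a cell,
  so the two cannot be confused.\<close>

definition topT :: "(tree \<Rightarrow> tree \<Rightarrow> tree) \<Rightarrow> tree \<Rightarrow> tree \<Rightarrow> tree" where
  "topT win ts q = foldT (\<lambda>e m. ifT (memT q (win ts (wtT e)))
     (ifT m (ifT (leQ m (wtT e)) (wtT e) m) (wtT e)) m) ts Atom"

lemma nodes_top_step: "nodes (ifT c (ifT m (ifT d (wtT e) m) (wtT e)) m) \<le> nodes m + nodes e"
  using nodes_proj_le(3)[of e] by (auto simp: ifT_def intro: trans_le_add1 trans_le_add2)

lemma ptime_topT:
  assumes "\<And>f g. ptime f \<Longrightarrow> ptime g \<Longrightarrow> ptime (\<lambda>z. win (f z) (g z))"
    and "ptime ts" "ptime q"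
  shows "ptime (\<lambda>z. topT win (ts z) (q z))"
  unfolding topT_def
proof (rule ptime_foldT[where r = "[:0, 1:]"])
  show "nodes (ifT (c z e) (ifT m (ifT (d m e) (wtT e) m) (wtT e)) m)
      \<le> nodes m + poly [:0, 1:] (nodes z + nodes e)"
    for c d :: "tree \<Rightarrow> tree \<Rightarrow> tree" and z e m
    by (rule order_trans[OF nodes_top_step]) simp
qed (intro ptime_intros assms assms(2,3)[THEN ptime_comp])+

text \<open>The fold reverses the list, which is harmless because a representation may list the
  transitions in any order.\<close>

definition reweightT :: "(tree \<Rightarrow> tree) \<Rightarrow> tree \<Rightarrow> tree" where
  "reweightT g ts = foldT (\<lambda>e a.
     Cell (Cell (srcT e) (Cell (letT e) (Cell (g e) (Cell (tgtT e) Atom)))) a) ts Atom"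

lemma ptime_reweightT:
  assumes "ptime ts" "ptime (\<lambda>z. g (left z) (right z))"
  shows "ptime (\<lambda>z. reweightT (g z) (ts z))"
proof -
  obtain p :: "nat poly" where p: "\<And>z. nodes (g (left z) (right z)) \<le> poly p (nodes z)"
    using ptime_nodes_le[OF assms(2)] by blast
  show ?thesis
    unfolding reweightT_def
  proof (rule ptime_foldT[where r = "[:6, 3:] + pcompose p [:1, 1:]"])
    show "nodes (Cell (Cell (srcT e) (Cell (letT e) (Cell (g z e) (Cell (tgtT e) Atom)))) a)
      \<le> nodes a + poly ([:6, 3:] + pcompose p [:1, 1:]) (nodes z + nodes e)" for z e a
      using nodes_proj_le[of e] p[of "Cell z e"] by (simp add: poly_pcompose)
    have "ptime (\<lambda>z. Cell (left z) (left (right z)))"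
      by (intro ptime_intros)
    from ptime_comp[OF assms(2) this]
    have "ptime (\<lambda>z. g (left z) (left (right z)))"
      by simp
    then show "ptime (\<lambda>z. Cell (Cell (srcT (left (right z))) (Cell (letT (left (right z)))
        (Cell (g (left z) (left (right z))) (Cell (tgtT (left (right z))) Atom)))) (right (right z)))"
      by (intro ptime_intros)
  qed (intro ptime_intros assms)+
qed

definition safeT :: "(tree \<Rightarrow> tree \<Rightarrow> tree) \<Rightarrow> tree \<Rightarrow> tree" where
  "safeT win ts = reweightT (\<lambda>e. topT win ts (tgtT e)) ts"

definition liveT :: "(tree \<Rightarrow> tree \<Rightarrow> tree) \<Rightarrow> tree \<Rightarrow> tree \<Rightarrow> tree" where
  "liveT win q ts = reweightT (\<lambda>e. ifT (leQ (topT win ts (tgtT e)) (wtT e)) (topT win ts q) (wtT e)) ts"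

definition decompT :: "(tree \<Rightarrow> tree \<Rightarrow> tree) \<Rightarrow> tree \<Rightarrow> tree" where
  "decompT win t =
    (let h = (\<lambda>s. Cell (left t) (Cell (left (right t)) (Cell (left (right (right t))) (Cell s Atom))));
       ts = left (right (right (right t)))
     in Cell (h (safeT win ts)) (h (liveT win (left (right (right t))) ts)))"

lemma ptime_decompT:
  assumes "\<And>f g. ptime f \<Longrightarrow> ptime g \<Longrightarrow> ptime (\<lambda>z. win (f z) (g z))"
  shows "ptime (decompT win)"
  unfolding decompT_def[abs_def] Let_def safeT_def liveT_def
  by (intro ptime_intros ptime_reweightT ptime_topT assms)

section \<open>Correctness of the programs: sets of states as lists of names\<close>

definition represents_set :: "tree \<Rightarrow> nat set \<Rightarrow> bool" where
  "represents_set Y S \<longleftrightarrow> (\<exists>l. Y = tree_of_list (map tree_of_nat l) \<and> S = set l)"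

lemma represents_setI: "represents_set (tree_of_list (map tree_of_nat l)) (set l)"
  by (auto simp: represents_set_def)

lemma represents_set_memT: "represents_set Y S \<Longrightarrow> memT (tree_of_nat n) Y \<noteq> Atom \<longleftrightarrow> n \<in> S"
  unfolding represents_set_def using memT_iff by blast

lemma represents_set_empty: "represents_set Atom {}"
  by (auto simp: represents_set_def intro: exI[of _ "[]"])

lemma represents_set_funpow:
  assumes "\<And>Y S. represents_set Y S \<Longrightarrow> represents_set (g Y) (G S)" "represents_set Y S"
  shows "represents_set ((g ^^ n) Y) ((G ^^ n) S)"
  using assms by (induction n) auto

lemma foldT_iterate: "foldT (\<lambda>_. g) (tree_of_list ts) a = (g ^^ length ts) a"
  by (induction ts arbitrary: a) (simp_all add: funpow_swap1)

lemma fold_collect: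
  "fold (\<lambda>e a. if P e then Cell (g e) a else a) es (tree_of_list l) =
     tree_of_list (rev (map g (filter P es)) @ l)"
  by (induction es arbitrary: l) (simp_all flip: tree_of_list.simps(2))

type_synonym edges = "(nat \<times> nat \<times> rat \<times> nat) set"

definition step_set :: "edges \<Rightarrow> rat \<Rightarrow> nat set \<Rightarrow> nat set \<Rightarrow> nat set" where
  "step_set E x S R = {i. \<exists>k w j. (i, k, w, j) \<in> E \<and> (x \<le> w \<and> j \<in> S \<or> j \<in> R)}"

lemma step_set_mono: "S \<subseteq> S' \<Longrightarrow> R \<subseteq> R' \<Longrightarrow> step_set E x S R \<subseteq> step_set E x S' R'"
  by (fastforce simp: step_set_def)

lemma step_set_subset: "step_set E x S R \<subseteq> fst ` E"
  by (force simp: step_set_def)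

definition tree_of_transitions :: "(nat \<times> nat \<times> rat \<times> nat) list \<Rightarrow> tree" where
  "tree_of_transitions ts = tree_of_list (map tree_of_transition ts)"

lemma tree_of_transition_proj [simp]:
  "srcT (tree_of_transition (i, k, w, j)) = tree_of_nat i"
  "letT (tree_of_transition (i, k, w, j)) = tree_of_nat k"
  "wtT (tree_of_transition (i, k, w, j)) = tree_of_rat w"
  "tgtT (tree_of_transition (i, k, w, j)) = tree_of_nat j"
  by simp_all

lemma srcT_tree_of_transition: "srcT (tree_of_transition e) = tree_of_nat (fst e)"
  by (cases e) simp

lemma represents_stepT:
  assumes "represents_set Y S" "represents_set R S'"
  shows "represents_set (stepT (tree_of_transitions ts) (tree_of_rat x) Y R) (step_set (set ts) x S S')"
proof -
  let ?P = "\<lambda>(i, k, w, j). x \<le> w \<and> j \<in> S \<or> j \<in> S'"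
  have step: "ifT (ifT (ifT (leQ (tree_of_rat x) (wtT (tree_of_transition e)))
        (memT (tgtT (tree_of_transition e)) Y) Atom) trueT (memT (tgtT (tree_of_transition e)) R))
       (Cell (srcT (tree_of_transition e)) a) a =
      (if ?P e then Cell (tree_of_nat (fst e)) a else a)" for e a
    using leQ_iff[of x] represents_set_memT[OF assms(1)] represents_set_memT[OF assms(2)]
    by (cases e) (auto simp: ifT_def simp del: tree_of_transition.simps)
  have "stepT (tree_of_transitions ts) (tree_of_rat x) Y R =
      fold (\<lambda>e a. if ?P e then Cell (tree_of_nat (fst e)) a else a) ts (tree_of_list [])"
    by (simp add: stepT_def tree_of_transitions_def foldT_tree_of_list fold_map o_def step
        del: tree_of_transition.simps)
  also have "\<dots> = tree_of_list (map tree_of_nat (rev (map fst (filter ?P ts))))"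
    unfolding fold_collect by (simp add: rev_map o_def)
  finally have "represents_set (stepT (tree_of_transitions ts) (tree_of_rat x) Y R)
      (set (rev (map fst (filter ?P ts))))"
    by (simp only: represents_setI)
  also have "set (rev (map fst (filter ?P ts))) = step_set (set ts) x S S'"
    by (auto simp: step_set_def image_iff Bex_def) blast+
  finally show ?thesis .
qed

text \<open>Otherwise each of \<open>card D + 1\<close> strict steps would change the cardinality in
  the same direction, beyond what \<open>D\<close> leaves room for.\<close>

lemma chain_stationary:
  fixes f :: "nat \<Rightarrow> 'a set"
  assumes "finite D" "\<And>k. f k \<subseteq> D" "(\<forall>k. f k \<subseteq> f (Suc k)) \<or> (\<forall>k. f (Suc k) \<subseteq> f k)"
  shows "\<exists>k\<le>card D. f (Suc k) = f k"
proof (rule ccontr)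
  assume neg: "\<not> ?thesis"
  have fin: "finite (f k)" "card (f k) \<le> card D" for k
    using finite_subset[OF assms(2,1)] card_mono[OF assms(1,2)] by auto
  from assms(3) show False
  proof
    assume "\<forall>k. f k \<subseteq> f (Suc k)"
    then have "k \<le> Suc (card D) \<Longrightarrow> k \<le> card (f k)" for k
    proof (induction k)
      case (Suc k)
      then have "f k \<subset> f (Suc k)"
        using neg by auto
      then show ?case
        using Suc psubset_card_mono[OF fin(1)[of "Suc k"], of "f k"] by simp
    qed simp
    from this[of "Suc (card D)"] show False
      using fin(2)[of "Suc (card D)"] by simp
  next
    assume "\<forall>k. f (Suc k) \<subseteq> f k"
    then have "k \<le> Suc (card D) \<Longrightarrow> card (f k) + k \<le> card D" for k
    proof (induction k)
      case (Suc k)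
      then have "f (Suc k) \<subset> f k"
        using neg by auto
      then show ?case
        using Suc psubset_card_mono[OF fin(1)[of k], of "f (Suc k)"] by simp
    qed (use fin in simp)
    from this[of "Suc (card D)"] show False
      by simp
  qed
qed

lemma funpow_stationary:
  assumes "(G ^^ Suc k) a = (G ^^ k) a" "k \<le> n"
  shows "G ((G ^^ n) a) = (G ^^ n) a"
  using assms(2)
proof (induction n rule: dec_induct)
  case base
  then show ?case using assms(1) by simp
qed simp

lemma funpow_lfp:
  assumes G: "mono G" and D: "\<And>S. G S \<subseteq> D" "finite D" "card D \<le> n"
  shows "(G ^^ n) {} = lfp G"
proof (rule antisym)
  have "(G ^^ k) {} \<subseteq> (G ^^ Suc k) {}" for k
    using funpow_mono[OF G, of "{}" "G {}" k] by (simp add: funpow_swap1)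
  moreover have "(G ^^ k) {} \<subseteq> D" for k
    using D(1) by (cases k) auto
  ultimately obtain k where "k \<le> card D" "(G ^^ Suc k) {} = (G ^^ k) {}"
    using chain_stationary[OF D(2), of "\<lambda>k. (G ^^ k) {}"] by blast
  then have "G ((G ^^ n) {}) = (G ^^ n) {}"
    using D(3) by (intro funpow_stationary[where k = k]) auto
  then show "lfp G \<subseteq> (G ^^ n) {}"
    by (intro lfp_lowerbound) simp
  show "(G ^^ n) {} \<subseteq> lfp G"
    using Kleene_iter_lpfp[OF G, of "lfp G" n] eq_refl[OF lfp_unfold[OF G, symmetric]] by simp
qed

text \<open>All values of \<open>G\<close> lie in \<open>D\<close>, hence so does the greatest
  fixpoint, and the iteration may start from the finite \<open>D\<close> instead of the whole
  type.\<close>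

lemma funpow_gfp:
  assumes G: "mono G" and D: "\<And>S. G S \<subseteq> D" "finite D" "card D \<le> n"
  shows "(G ^^ n) D = gfp G"
proof (rule antisym)
  have "(G ^^ Suc k) D \<subseteq> (G ^^ k) D" for k
    using funpow_mono[OF G D(1)[of D], of k] by (simp add: funpow_swap1)
  moreover have "(G ^^ k) D \<subseteq> D" for k
    using D(1) by (cases k) auto
  ultimately obtain k where "k \<le> card D" "(G ^^ Suc k) D = (G ^^ k) D"
    using chain_stationary[OF D(2), of "\<lambda>k. (G ^^ k) D"] by blast
  then have "G ((G ^^ n) D) = (G ^^ n) D"
    using D(3) by (intro funpow_stationary[where k = k]) auto
  then show "(G ^^ n) D \<subseteq> gfp G"
    by (intro gfp_upperbound) simp
  have "gfp G \<subseteq> D"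
    by (subst gfp_unfold[OF G]) (rule D(1))
  then show "gfp G \<subseteq> (G ^^ n) D"
  proof (induction n)
    case (Suc n)
    from Suc.IH Suc.prems have "G (gfp G) \<subseteq> G ((G ^^ n) D)"
      by (intro monoD[OF G])
    then show ?case
      by (subst gfp_unfold[OF G]) simp
  qed simp
qed

lemma card_sources_le: "card (fst ` set ts) \<le> length ts"
  by (metis card_length length_map set_map)

definition reach_set :: "edges \<Rightarrow> rat \<Rightarrow> nat set \<Rightarrow> nat set" where
  "reach_set E x S = lfp (step_set E x S)"

text \<open>The nested fixpoint for a Buechi condition, greatest outside and least inside: every
  state of the set can reach a good edge leading back into the set.\<close>

definition winS :: "edges \<Rightarrow> rat \<Rightarrow> nat set" where
  "winS E x = gfp (reach_set E x)"

definition stay_set :: "edges \<Rightarrow> rat \<Rightarrow> nat set" where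
  "stay_set E x = gfp (\<lambda>S. step_set E x S {})"

text \<open>\<open>reach_set\<close> asks for a good edge into the stay set. This amounts to plain
  reachability, as each state of the stay set has such an edge itself.\<close>

definition winI :: "edges \<Rightarrow> rat \<Rightarrow> nat set" where
  "winI E x = reach_set E x (stay_set E x)"

lemma mono_step_set: "mono (step_set E x S)" "mono (\<lambda>S. step_set E x S {})"
  by (intro monoI step_set_mono; simp)+

lemma mono_reach_set: "mono (reach_set E x)"
  unfolding reach_set_def by (intro monoI lfp_mono step_set_mono) auto

lemma reach_set_subset: "reach_set E x S \<subseteq> fst ` E"
  unfolding reach_set_def by (rule lfp_lowerbound) (rule step_set_subset)

lemma foldT_iterate_transitions:
  "foldT (\<lambda>_. g) (tree_of_transitions ts) a = (g ^^ length ts) a"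
  by (simp add: tree_of_transitions_def foldT_iterate)

lemma represents_lfpT:
  assumes "represents_set Y S"
  shows "represents_set (lfpT (tree_of_transitions ts) (tree_of_rat x) Y) (reach_set (set ts) x S)"
proof -
  have "represents_set (lfpT (tree_of_transitions ts) (tree_of_rat x) Y)
      ((step_set (set ts) x S ^^ length ts) {})"
    unfolding lfpT_def foldT_iterate_transitions
    by (intro represents_set_funpow represents_stepT assms represents_set_empty)
  then show ?thesis
    unfolding reach_set_def
    by (subst (asm) funpow_lfp[OF mono_step_set(1) step_set_subset]) (auto simp: card_sources_le)
qed

lemma represents_allT: "represents_set (allT (tree_of_transitions ts)) (fst ` set ts)"
proof -
  have "allT (tree_of_transitions ts) = tree_of_list (map tree_of_nat (rev (map fst ts)))"
    using fold_collect[of "\<lambda>_. True" "\<lambda>e. tree_of_nat (fst e)" ts "[]"]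
    by (simp add: allT_def tree_of_transitions_def foldT_tree_of_list fold_map o_def rev_map
      srcT_tree_of_transition)
  then show ?thesis
    using represents_setI[of "rev (map fst ts)"] by simp
qed

lemma represents_winS_T:
  "represents_set (winS_T (tree_of_transitions ts) (tree_of_rat x)) (winS (set ts) x)"
proof -
  have "represents_set (winS_T (tree_of_transitions ts) (tree_of_rat x))
      ((reach_set (set ts) x ^^ length ts) (fst ` set ts))"
    unfolding winS_T_def foldT_iterate_transitions
    by (intro represents_set_funpow represents_lfpT represents_allT)
  then show ?thesis
    unfolding winS_def
    by (subst (asm) funpow_gfp[OF mono_reach_set reach_set_subset]) (auto simp: card_sources_le)
qed

lemma represents_winI_T:
  "represents_set (winI_T (tree_of_transitions ts) (tree_of_rat x)) (winI (set ts) x)"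
proof -
  have "represents_set (foldT (\<lambda>_ Y. stepT (tree_of_transitions ts) (tree_of_rat x) Y Atom)
        (tree_of_transitions ts) (allT (tree_of_transitions ts)))
      (((\<lambda>S. step_set (set ts) x S {}) ^^ length ts) (fst ` set ts))"
    unfolding foldT_iterate_transitions
    by (intro represents_set_funpow represents_stepT represents_allT represents_set_empty)
  then have "represents_set (foldT (\<lambda>_ Y. stepT (tree_of_transitions ts) (tree_of_rat x) Y Atom)
        (tree_of_transitions ts) (allT (tree_of_transitions ts))) (stay_set (set ts) x)"
    unfolding stay_set_def
    by (subst (asm) funpow_gfp[OF mono_step_set(2) step_set_subset]) (auto simp: card_sources_le)
  then show ?thesis
    unfolding winI_T_def winI_def by (rule represents_lfpT)
qed

text \<open>Testing only weights that occur suffices, because the value of every run is one of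
  them.\<close>

definition top_of :: "(rat \<Rightarrow> nat set) \<Rightarrow> edges \<Rightarrow> nat \<Rightarrow> rat" where
  "top_of W E q = Max {w. \<exists>i k j. (i, k, w, j) \<in> E \<and> q \<in> W w}"

lemma topT_eq:
  assumes win: "\<And>x. represents_set (win (tree_of_transitions ts) (tree_of_rat x)) (W x)"
  shows "topT win (tree_of_transitions ts) (tree_of_nat q) =
    (if {w. \<exists>i k j. (i, k, w, j) \<in> set ts \<and> q \<in> W w} = {} then Atom
     else tree_of_rat (top_of W (set ts) q))"
proof -
  define T where "T = tree_of_transitions ts"
  define A where "A = (\<lambda>us :: (nat \<times> nat \<times> rat \<times> nat) list. {w. \<exists>i k j. (i, k, w, j) \<in> set us \<and> q \<in> W w})"
  define h where "h = (\<lambda>e m. ifT (memT (tree_of_nat q) (win T (wtT e)))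
     (ifT m (ifT (leQ m (wtT e)) (wtT e) m) (wtT e)) m)"
  have fin: "finite (A us)" for us
    by (rule finite_subset[of _ "(\<lambda>(i, k, w, j). w) ` set us"]) (force simp: A_def)+
  have rat_nonatom: "tree_of_rat w \<noteq> Atom" for w
    by (simp add: tree_of_rat_def split: prod.splits)
  have "fold h (map tree_of_transition us) Atom =
      (if A us = {} then Atom else tree_of_rat (Max (A us)))" for us
  \<comment> \<open>\<open>fold\<close> consumes the list from the front, so its accumulator
    describes a prefix.\<close>
  proof (induction us rule: rev_induct)
    case Nil
    show ?case by (simp add: A_def)
  next
    case (snoc e us)
    obtain i k w j where e: "e = (i, k, w, j)" by (cases e)
    have A: "A (us @ [e]) = (if q \<in> W w then insert w (A us) else A us)"
      by (auto simp: A_def e)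
    have h: "h (tree_of_transition e) m = (if q \<in> W w then
        (if m = Atom then tree_of_rat w else if leQ m (tree_of_rat w) = Atom then m else tree_of_rat w) else m)" for m
      using represents_set_memT[OF win, of q w]
      by (auto simp: h_def T_def e ifT_def simp del: tree_of_transition.simps)
    show ?case
      using leQ_iff[of "Max (A us)" w] fin[of us]
      by (auto simp: snoc A h rat_nonatom max_def simp del: tree_of_transition.simps)
  qed
  from this[of ts] have "foldT h T Atom = (if A ts = {} then Atom else tree_of_rat (Max (A ts)))"
    by (simp add: T_def tree_of_transitions_def foldT_tree_of_list)
  then show ?thesis
    by (simp only: topT_def h_def T_def A_def top_of_def)
qed

lemma reweightT_eq:
  assumes "\<And>e. e \<in> set ts \<Longrightarrow> g (tree_of_transition e) = tree_of_rat (h e)"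
  shows "reweightT g (tree_of_transitions ts) =
    tree_of_transitions (rev (map (\<lambda>e. case e of (i, k, w, j) \<Rightarrow> (i, k, h e, j)) ts))"
proof -
  let ?f = "\<lambda>e. case e of (i, k, w, j) \<Rightarrow> (i, k, h e, j)"
  let ?c = "\<lambda>e. Cell (srcT e) (Cell (letT e) (Cell (g e) (Cell (tgtT e) Atom)))"
  have "reweightT g (tree_of_transitions ts) = tree_of_list (rev (map (\<lambda>e. ?c (tree_of_transition e)) ts))"
    using fold_collect[of "\<lambda>_. True" "\<lambda>e. ?c (tree_of_transition e)" ts "[]"]
    by (simp add: reweightT_def tree_of_transitions_def foldT_tree_of_list fold_map o_def)
  also have "map (\<lambda>e. ?c (tree_of_transition e)) ts = map (tree_of_transition \<circ> ?f) ts"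
    using assms by (intro map_cong) auto
  finally show ?thesis
    by (simp add: tree_of_transitions_def rev_map)
qed

section \<open>Limits inferior and superior of weight sequences\<close>

definition io_ge :: "(nat \<Rightarrow> rat) \<Rightarrow> rat \<Rightarrow> bool" where
  "io_ge xs y \<longleftrightarrow> (\<forall>m. \<exists>n\<ge>m. y \<le> xs n)"

definition ev_ge :: "(nat \<Rightarrow> rat) \<Rightarrow> rat \<Rightarrow> bool" where
  "ev_ge xs y \<longleftrightarrow> (\<exists>m. \<forall>n\<ge>m. y \<le> xs n)"

text \<open>The second assumption makes \<open>P y\<close> depend only on which entries are at least
  \<open>y\<close>. With finitely many values such a property can change only at an entry; the cut
  is the greatest entry having it.\<close>

lemma cut_exists:
  fixes xs :: "nat \<Rightarrow> rat"
  assumes fin: "finite (range xs)"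
    and mono: "\<And>y y'. P y \<Longrightarrow> (\<And>m. y \<le> xs m \<Longrightarrow> y' \<le> xs m) \<Longrightarrow> P y'"
    and all: "\<And>y. (\<And>m. y \<le> xs m) \<Longrightarrow> P y"
    and ex: "\<And>y. P y \<Longrightarrow> \<exists>m. y \<le> xs m"
  shows "\<exists>w\<in>range xs. \<forall>y. P y \<longleftrightarrow> y \<le> w"
proof -
  define A where "A = {y \<in> range xs. P y}"
  have "finite A" using fin by (auto simp: A_def)
  have "Min (range xs) \<in> A"
    using fin by (auto simp: A_def intro!: all)
  with \<open>finite A\<close> have "Max A \<in> A"
    by (intro Max_in) auto
  show ?thesis
  proof (intro bexI[of _ "Max A"] allI iffI)
    fix y assume "P y"
    define C where "C = {z \<in> range xs. y \<le> z}"
    have C: "finite C" "C \<noteq> {}"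
      using fin ex[OF \<open>P y\<close>] by (auto simp: C_def)
    then have "Min C \<in> C" by simp
    have "P (Min C)"
      using C by (intro mono[OF \<open>P y\<close>]) (auto simp: C_def)
    then have "Min C \<in> A"
      using \<open>Min C \<in> C\<close> by (auto simp: A_def C_def)
    then have "Min C \<le> Max A"
      using \<open>finite A\<close> by simp
    then show "y \<le> Max A"
      using \<open>Min C \<in> C\<close> by (auto simp: C_def)
  next
    fix y assume "y \<le> Max A"
    then show "P y"
      using \<open>Max A \<in> A\<close> by (auto simp: A_def intro: mono[of "Max A"])
  qed (use \<open>Max A \<in> A\<close> in \<open>auto simp: A_def\<close>)
qed

text \<open>Finitely many values leave a gap above \<open>w\<close>. This translates between the
  strict bounds that characterize the limits and the nonstrict thresholds of \<open>io_ge\<close>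
  and \<open>ev_ge\<close>.\<close>

lemma gap_above:
  fixes xs :: "nat \<Rightarrow> rat"
  assumes "finite (range xs)"
  shows "\<exists>y>w. \<forall>m. w < xs m \<longrightarrow> y \<le> xs m"
proof (cases "{z \<in> range xs. w < z} = {}")
  case True
  then show ?thesis by (intro exI[of _ "w + 1"]) auto
next
  case False
  have fin: "finite {z \<in> range xs. w < z}" using assms by simp
  show ?thesis
  proof (intro exI conjI allI impI)
    show "w < Min {z \<in> range xs. w < z}"
      using Min_in[OF fin False] by simp
    show "Min {z \<in> range xs. w < z} \<le> xs m" if "w < xs m" for m
      using that fin by (intro Min_le) auto
  qed
qed

text \<open>What the argument needs to know about \<open>LimInf\<close> and \<open>LimSup\<close>: on sequences of finite range
  both are the greatest threshold for which an acceptance condition insensitive to finite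
  prefixes holds.\<close>

locale threshold_value =
  fixes Val :: value_function and acc :: "(nat \<Rightarrow> rat) \<Rightarrow> rat \<Rightarrow> bool"
  assumes val_acc: "finite (range xs) \<Longrightarrow>
      \<exists>w\<in>range xs. Val xs = ereal (real_of_rat w) \<and> (\<forall>y. acc xs y \<longleftrightarrow> y \<le> w)"
    and acc_shift: "acc (\<lambda>m. xs (m + k)) y \<longleftrightarrow> acc xs y"
    and acc_const: "(\<And>m. m0 \<le> m \<Longrightarrow> xs m = T) \<Longrightarrow> acc xs y \<longleftrightarrow> y \<le> T"
    and acc_lift: "(\<And>y. acc xs y \<longleftrightarrow> y \<le> v) \<Longrightarrow> v \<le> T \<Longrightarrow> T \<le> M \<Longrightarrow>
      (\<And>m. m0 \<le> m \<Longrightarrow> c m = (if T \<le> xs m then M else xs m)) \<Longrightarrow>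
      acc c y \<longleftrightarrow> y \<le> (if v = T then M else v)"
begin

lemma val_eqI:
  assumes "finite (range xs)" "\<And>y. acc xs y \<longleftrightarrow> y \<le> w"
  shows "Val xs = ereal (real_of_rat w)"
  using val_acc[OF assms(1)] assms(2) by (metis order_antisym order_refl)

end

text \<open>For \<open>acc_lift\<close>: if \<open>v = T\<close>, entries at least \<open>T\<close>
  recur and each becomes \<open>M\<close>; if \<open>v < T\<close>, the entries are eventually below
  \<open>T\<close> and nothing changes.\<close>

lemma threshold_value_LimSup: "threshold_value LimSup io_ge"
proof
  fix xs :: "nat \<Rightarrow> rat"
  assume fin: "finite (range xs)"
  have "\<exists>w\<in>range xs. \<forall>y. io_ge xs y \<longleftrightarrow> y \<le> w"
  proof (rule cut_exists[OF fin])
    show "io_ge xs y'" if "io_ge xs y" "\<And>m. y \<le> xs m \<Longrightarrow> y' \<le> xs m" for y y'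
      using that unfolding io_ge_def by blast
  qed (auto simp: io_ge_def)
  then obtain w where w: "w \<in> range xs" "\<And>y. io_ge xs y \<longleftrightarrow> y \<le> w"
    by blast
  have "LimSup xs = ereal (real_of_rat w)"
  proof (rule antisym)
    obtain y where y: "y > w" "\<And>m. w < xs m \<Longrightarrow> y \<le> xs m"
      using gap_above[OF fin, of w] by blast
    have "\<not> io_ge xs y"
      using w y by simp
    then obtain m where "\<And>n. n \<ge> m \<Longrightarrow> xs n < y"
      unfolding io_ge_def by (meson not_le)
    with y have "\<And>n. n \<ge> m \<Longrightarrow> xs n \<le> w"
      by (meson not_le)
    then show "LimSup xs \<le> ereal (real_of_rat w)"
      unfolding LimSup_def
      by (intro Limsup_bounded) (auto simp: eventually_sequentially of_rat_less_eq)
    show "ereal (real_of_rat w) \<le> LimSup xs"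
    proof (rule ccontr)
      assume "\<not> ?thesis"
      then have "eventually (\<lambda>n. ereal (real_of_rat (xs n)) < ereal (real_of_rat w)) sequentially"
        unfolding LimSup_def by (intro Limsup_lessD) simp
      then obtain m where "\<And>n. n \<ge> m \<Longrightarrow> xs n < w"
        by (auto simp: eventually_sequentially of_rat_less)
      then have "\<not> io_ge xs w"
        unfolding io_ge_def by (meson not_le)
      then show False using w by simp
    qed
  qed
  then show "\<exists>w\<in>range xs. LimSup xs = ereal (real_of_rat w) \<and> (\<forall>y. io_ge xs y \<longleftrightarrow> y \<le> w)"
    using w by blast
next
  fix xs :: "nat \<Rightarrow> rat" and k y
  show "io_ge (\<lambda>m. xs (m + k)) y \<longleftrightarrow> io_ge xs y"
    unfolding io_ge_def
    by (metis add.commute add_leD2 add_le_cancel_right le_add_diff_inverse2 trans_le_add1)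
next
  fix xs :: "nat \<Rightarrow> rat" and m0 T y
  assume "\<And>m. m0 \<le> m \<Longrightarrow> xs m = T"
  then show "io_ge xs y \<longleftrightarrow> y \<le> T"
    unfolding io_ge_def by (metis nle_le)
next
  fix xs c :: "nat \<Rightarrow> rat" and m0 y v T M
  assume xs: "\<And>y. io_ge xs y \<longleftrightarrow> y \<le> v" and le: "v \<le> T" "T \<le> M"
    and c: "\<And>m. m0 \<le> m \<Longrightarrow> c m = (if T \<le> xs m then M else xs m)"
  show "io_ge c y \<longleftrightarrow> y \<le> (if v = T then M else v)"
  proof (cases "v = T")
    case True
    have "io_ge c M"
      unfolding io_ge_def
    proof
      fix m
      have "io_ge xs T"
        using xs True by simp
      then obtain n where "n \<ge> max m m0" "T \<le> xs n"
        unfolding io_ge_def by blast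
      then show "\<exists>n\<ge>m. M \<le> c n"
        using c[of n] by (intro exI[of _ n]) auto
    qed
    moreover have "c m \<le> M" if "m0 \<le> m" for m
      using c[OF that] le by auto
    ultimately have "io_ge c y \<longleftrightarrow> y \<le> M"
      unfolding io_ge_def by (meson order_trans nat_le_linear)
    then show ?thesis using True by simp
  next
    case False
    then have "\<not> io_ge xs T"
      using xs le by simp
    then obtain m1 where "\<And>n. n \<ge> m1 \<Longrightarrow> xs n < T"
      unfolding io_ge_def by (meson not_le)
    then have "c n = xs n" if "n \<ge> max m0 m1" for n
      using that c[of n] by fastforce
    then have "io_ge c y \<longleftrightarrow> io_ge xs y"
      unfolding io_ge_def by (metis max.bounded_iff nle_le order_trans)
    then show ?thesis using False xs by simp
  qed
qed

text \<open>For \<open>acc_lift\<close>: if \<open>v = T\<close>, the new sequence is eventually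
  constant \<open>M\<close>; if \<open>v < T\<close>, entries below \<open>T\<close> recur
  unchanged, while raising the others does not affect comparison with any
  \<open>y \<le> T\<close>.\<close>

lemma threshold_value_LimInf: "threshold_value LimInf ev_ge"
proof
  fix xs :: "nat \<Rightarrow> rat"
  assume fin: "finite (range xs)"
  have "\<exists>w\<in>range xs. \<forall>y. ev_ge xs y \<longleftrightarrow> y \<le> w"
  proof (rule cut_exists[OF fin])
    show "ev_ge xs y'" if "ev_ge xs y" "\<And>m. y \<le> xs m \<Longrightarrow> y' \<le> xs m" for y y'
      using that unfolding ev_ge_def by blast
  qed (auto simp: ev_ge_def)
  then obtain w where w: "w \<in> range xs" "\<And>y. ev_ge xs y \<longleftrightarrow> y \<le> w"
    by blast
  have "LimInf xs = ereal (real_of_rat w)"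
  proof (rule antisym)
    have "ev_ge xs w" using w by simp
    then show "ereal (real_of_rat w) \<le> LimInf xs"
      unfolding LimInf_def ev_ge_def
      by (intro Liminf_bounded) (auto simp: eventually_sequentially of_rat_less_eq)
    show "LimInf xs \<le> ereal (real_of_rat w)"
    proof (rule ccontr)
      assume "\<not> ?thesis"
      then have "eventually (\<lambda>n. ereal (real_of_rat w) < ereal (real_of_rat (xs n))) sequentially"
        unfolding LimInf_def by (intro less_LiminfD) simp
      then obtain m where m: "\<And>n. n \<ge> m \<Longrightarrow> w < xs n"
        by (auto simp: eventually_sequentially of_rat_less)
      obtain y where y: "y > w" "\<And>m. w < xs m \<Longrightarrow> y \<le> xs m"
        using gap_above[OF fin, of w] by blast
      then have "ev_ge xs y"
        using m by (auto simp: ev_ge_def)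
      then show False using w y by simp
    qed
  qed
  then show "\<exists>w\<in>range xs. LimInf xs = ereal (real_of_rat w) \<and> (\<forall>y. ev_ge xs y \<longleftrightarrow> y \<le> w)"
    using w by blast
next
  fix xs :: "nat \<Rightarrow> rat" and k y
  show "ev_ge (\<lambda>m. xs (m + k)) y \<longleftrightarrow> ev_ge xs y"
    unfolding ev_ge_def
    by (metis add_leD2 add_le_cancel_right le_add_diff_inverse2 trans_le_add1)
next
  fix xs :: "nat \<Rightarrow> rat" and m0 T y
  assume "\<And>m. m0 \<le> m \<Longrightarrow> xs m = T"
  then show "ev_ge xs y \<longleftrightarrow> y \<le> T"
    unfolding ev_ge_def by (metis nle_le)
next
  fix xs c :: "nat \<Rightarrow> rat" and m0 y v T M
  assume xs: "\<And>y. ev_ge xs y \<longleftrightarrow> y \<le> v" and le: "v \<le> T" "T \<le> M"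
    and c: "\<And>m. m0 \<le> m \<Longrightarrow> c m = (if T \<le> xs m then M else xs m)"
  show "ev_ge c y \<longleftrightarrow> y \<le> (if v = T then M else v)"
  proof (cases "v = T")
    case True
    then have "ev_ge xs T" using xs by simp
    then obtain m1 where "\<And>n. n \<ge> m1 \<Longrightarrow> T \<le> xs n"
      by (auto simp: ev_ge_def)
    then have "c n = M" if "n \<ge> max m0 m1" for n
      using that c[of n] by simp
    then have "ev_ge c y \<longleftrightarrow> y \<le> M"
      unfolding ev_ge_def by (metis nle_le)
    then show ?thesis using True by simp
  next
    case False
    then have nT: "\<not> ev_ge xs T"
      using xs le by simp
    show ?thesis
    proof (cases "y \<le> T")
      case True
      then have "y \<le> c n \<longleftrightarrow> y \<le> xs n" if "n \<ge> m0" for n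
        using c[OF that] le by auto
      then have "ev_ge c y \<longleftrightarrow> ev_ge xs y"
        unfolding ev_ge_def by (meson nat_le_linear order_trans)
      then show ?thesis using False xs by simp
    next
      case y: False
      have "\<not> ev_ge c y"
        unfolding ev_ge_def
      proof
        assume "\<exists>m. \<forall>n\<ge>m. y \<le> c n"
        then obtain m where m: "\<And>n. n \<ge> m \<Longrightarrow> y \<le> c n" by blast
        obtain n where "n \<ge> max m m0" "xs n < T"
          using nT unfolding ev_ge_def by (meson not_le)
        then show False
          using m[of n] c[of n] y by simp
      qed
      then show ?thesis using False y le by simp
    qed
  qed
qed

section \<open>Optimal values and the decomposition\<close>

text \<open>States are positions in the list that represents the automaton, the names used in the
  trees; determinism turns the transitions into the functions \<open>wt\<close> and
  \<open>tgt\<close>.\<close>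

locale det_graph =
  fixes ls :: "'s list" and n :: nat and wt :: "nat \<Rightarrow> 's \<Rightarrow> rat" and tgt :: "nat \<Rightarrow> 's \<Rightarrow> nat"
  assumes tgt_less: "i < n \<Longrightarrow> a \<in> set ls \<Longrightarrow> tgt i a < n"
begin

definition E :: edges where
  "E = {(i, k, wt i (ls ! k), tgt i (ls ! k)) |i k. i < n \<and> k < length ls}"

primrec st :: "nat \<Rightarrow> 's word \<Rightarrow> nat \<Rightarrow> nat" where
  "st i w 0 = i"
| "st i w (Suc m) = tgt (st i w m) (w m)"

definition ws :: "nat \<Rightarrow> 's word \<Rightarrow> nat \<Rightarrow> rat" where
  "ws i w m = wt (st i w m) (w m)"

abbreviation "words \<equiv> omega_words (set ls)"

lemma st_less: "i < n \<Longrightarrow> w \<in> words \<Longrightarrow> st i w m < n"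
  by (induction m) (auto simp: tgt_less omega_words_def)

lemma st_build: "st i (a ## w) (Suc m) = st (tgt i a) w m"
  by (induction m) auto

lemma ws_build: "ws i (a ## w) (m + 1) = ws (tgt i a) w m"
  using st_build[of i a w m] by (simp add: ws_def)

lemma words_build:
  assumes "a \<in> set ls" "w \<in> words"
  shows "a ## w \<in> words"
proof -
  have "(a ## w) m \<in> set ls" for m
    using assms by (cases m) (auto simp: omega_words_def)
  then show ?thesis by (simp add: omega_words_def)
qed

lemma st_suffix: "st (st i w k) (suffix k w) m = st i w (m + k)"
  by (induction m) (auto simp: add.commute)

lemma ws_suffix: "ws (st i w k) (suffix k w) = (\<lambda>m. ws i w (m + k))"
  by (rule ext) (simp add: ws_def st_suffix add.commute)

lemma words_suffix: "w \<in> words \<Longrightarrow> suffix k w \<in> words"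
  by (auto simp: omega_words_def)

lemma words_conc: "w \<in> words \<Longrightarrow> w' \<in> words \<Longrightarrow> prefix k w \<frown> w' \<in> words"
  by (auto simp: omega_words_def conc_def)

lemma st_conc: "m \<le> k \<Longrightarrow> st i (prefix k w \<frown> w') m = st i w m"
  by (induction m) auto

lemma finite_range_ws:
  assumes "i < n" "w \<in> words"
  shows "finite (range (ws i w))"
proof (rule finite_subset)
  show "range (ws i w) \<subseteq> (\<lambda>(p, a). wt p a) ` ({..<n} \<times> set ls)"
    using st_less[OF assms] assms(2) by (auto simp: ws_def omega_words_def image_iff)
qed auto

section \<open>The winning regions as fixpoints\<close>

lemma step_set_E:
  "step_set E x S R = {i. i < n \<and> (\<exists>a\<in>set ls. x \<le> wt i a \<and> tgt i a \<in> S \<or> tgt i a \<in> R)}"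
proof (intro equalityI subsetI)
  fix i assume "i \<in> step_set E x S R"
  then obtain k where "i < n" "ls ! k \<in> set ls" "x \<le> wt i (ls ! k) \<and> tgt i (ls ! k) \<in> S \<or> tgt i (ls ! k) \<in> R"
    unfolding step_set_def E_def using nth_mem by blast
  then show "i \<in> {i. i < n \<and> (\<exists>a\<in>set ls. x \<le> wt i a \<and> tgt i a \<in> S \<or> tgt i a \<in> R)}"
    by blast
next
  fix i assume "i \<in> {i. i < n \<and> (\<exists>a\<in>set ls. x \<le> wt i a \<and> tgt i a \<in> S \<or> tgt i a \<in> R)}"
  then obtain k where "i < n" "k < length ls"
    "x \<le> wt i (ls ! k) \<and> tgt i (ls ! k) \<in> S \<or> tgt i (ls ! k) \<in> R"
    by (auto simp: in_set_conv_nth)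
  then show "i \<in> step_set E x S R"
    unfolding step_set_def E_def by blast
qed

text \<open>\<open>d\<close> is the distance to a good edge into \<open>S\<close>; going backwards,
  the least fixpoint picks up the preceding states whatever the weights between.\<close>

lemma backward_reach:
  assumes w: "i < n" "w \<in> words" and g: "x \<le> ws i w (m + d)" "st i w (Suc (m + d)) \<in> S"
  shows "st i w m \<in> reach_set E x S"
  using g
proof (induction d arbitrary: m)
  case 0
  then have "st i w m \<in> step_set E x S (reach_set E x S)"
    using st_less[OF w, of m] w(2) by (auto simp: step_set_E ws_def omega_words_def)
  then show ?case
    unfolding reach_set_def using lfp_unfold[OF mono_step_set(1)] by blast
next
  case (Suc d)
  then have "st i w (Suc m) \<in> reach_set E x S"
    by (intro Suc.IH) auto
  then have "st i w m \<in> step_set E x S (reach_set E x S)"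
    using st_less[OF w, of m] w(2) by (auto simp: step_set_E omega_words_def)
  then show ?case
    unfolding reach_set_def using lfp_unfold[OF mono_step_set(1)] by blast
qed

text \<open>A letter chosen in each state determines both the run and the word, so with a single
  player it is enough to find a positional strategy that stays in \<open>L\<close>.\<close>

lemma word_of_strategy:
  assumes "\<And>i. i \<in> L \<Longrightarrow> f i \<in> set ls \<and> tgt i (f i) \<in> L" "i \<in> L"
  shows "\<exists>w\<in>words. \<forall>m. st i w m \<in> L \<and> w m = f (st i w m)"
proof -
  define q where "q = rec_nat i (\<lambda>_ p. tgt p (f p))"
  define w where "w m = f (q m)" for m
  have q: "q m \<in> L" for m
    by (induction m) (use assms in \<open>auto simp: q_def\<close>)
  have st: "st i w m = q m" for m
    by (induction m) (auto simp: w_def, auto simp: q_def)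
  show ?thesis
    using q st assms(1) by (intro bexI[of _ w]) (auto simp: omega_words_def w_def)
qed

lemma finite_E: "finite E"
proof -
  have "E = (\<lambda>(i, k). (i, k, wt i (ls ! k), tgt i (ls ! k))) ` ({..<n} \<times> {..<length ls})"
    by (auto simp: E_def)
  then show ?thesis by simp
qed

text \<open>Inside the winning set, moving to a state of smaller rank until a good edge is taken
  yields infinitely many good edges.\<close>

lemma winS_iff:
  assumes "i < n"
  shows "i \<in> winS E x \<longleftrightarrow> (\<exists>w\<in>words. io_ge (ws i w) x)"
proof
  assume "\<exists>w\<in>words. io_ge (ws i w) x"
  then obtain w where w: "w \<in> words" "io_ge (ws i w) x" by blast
  have "range (st i w) \<subseteq> reach_set E x (range (st i w))"
  proof clarify
    fix m
    obtain m' where "m' \<ge> m" "x \<le> ws i w m'"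
      using w(2) by (auto simp: io_ge_def)
    then show "st i w m \<in> reach_set E x (range (st i w))"
      by (intro backward_reach[OF assms w(1), where d = "m' - m"]) (simp_all del: st.simps)
  qed
  then have "range (st i w) \<subseteq> winS E x"
    unfolding winS_def by (rule gfp_upperbound)
  moreover have "i = st i w 0" by simp
  ultimately show "i \<in> winS E x" by blast
next
  assume i: "i \<in> winS E x"
  define L where "L = winS E x"
  define G where "G = step_set E x L"
  \<comment> \<open>The rank is the first iterate containing \<open>j\<close>. A state of rank
    \<open>Suc k\<close> has a good edge into \<open>L\<close> or an edge to a state of rank at most
    \<open>k\<close>; rank 0 is impossible, that iterate being empty.\<close>
  define r where "r j = (LEAST k. j \<in> (G ^^ k) {})" for j
  have L: "L = lfp G"
    using gfp_unfold[OF mono_reach_set, of E x] by (simp add: L_def winS_def reach_set_def G_def)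
  have lfp: "(G ^^ card (fst ` E)) {} = lfp G"
    unfolding G_def using finite_E
    by (intro funpow_lfp[OF mono_step_set(1) step_set_subset]) auto
  have mono: "mono G"
    unfolding G_def by (rule mono_step_set)
  have sub: "(G ^^ k) {} \<subseteq> L" for k
    using Kleene_iter_lpfp[OF mono eq_refl[OF lfp_unfold[OF mono, symmetric]]] by (simp flip: L)
  have r: "j \<in> (G ^^ r j) {}" if "j \<in> L" for j
    unfolding r_def by (rule LeastI[of _ "card (fst ` E)"]) (use that in \<open>simp add: lfp flip: L\<close>)
  have "\<exists>a\<in>set ls. tgt j a \<in> L \<and> (x \<le> wt j a \<or> r (tgt j a) < r j)" if "j \<in> L" for j
  proof (cases "r j")
    case 0
    then show ?thesis using r[OF that] by simp
  next
    case (Suc k)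
    then have "j \<in> step_set E x L ((G ^^ k) {})"
      using r[OF that] by (simp add: G_def)
    moreover have "r j' \<le> k" if "j' \<in> (G ^^ k) {}" for j'
      unfolding r_def using that by (rule Least_le)
    ultimately show ?thesis
      using Suc sub[of k] by (fastforce simp: step_set_E)
  qed
  then obtain f where f: "\<And>j. j \<in> L \<Longrightarrow> f j \<in> set ls \<and> tgt j (f j) \<in> L \<and>
      (x \<le> wt j (f j) \<or> r (tgt j (f j)) < r j)"
    by metis
  obtain w where w: "w \<in> words" "\<And>m. st i w m \<in> L" "\<And>m. w m = f (st i w m)"
    using word_of_strategy[of L f i] f i unfolding L_def by blast
  have "\<exists>n\<ge>m. x \<le> ws i w n" for m
  proof (induction "r (st i w m)" arbitrary: m rule: less_induct)
    case less
    show ?case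
    proof (cases "x \<le> ws i w m")
      case False
      then have "r (st i w (Suc m)) < r (st i w m)"
        using f[OF w(2)[of m]] w(3)[of m] by (simp add: ws_def)
      from less[OF this] show ?thesis
        using Suc_leD by blast
    qed auto
  qed
  then show "\<exists>w\<in>words. io_ge (ws i w) x"
    using w(1) by (auto simp: io_ge_def)
qed

text \<open>The tail of an accepted run is a post-fixpoint, so it lies in the stay set. Conversely,
  a word staying on good edges remains accepted when letters are put in front, which is the
  induction over the least fixpoint.\<close>

lemma winI_iff:
  assumes "i < n"
  shows "i \<in> winI E x \<longleftrightarrow> (\<exists>w\<in>words. ev_ge (ws i w) x)"
proof
  assume "\<exists>w\<in>words. ev_ge (ws i w) x"
  then obtain w m where w: "w \<in> words" "\<And>k. k \<ge> m \<Longrightarrow> x \<le> ws i w k"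
    by (auto simp: ev_ge_def)
  have "st i w ` {m..} \<subseteq> step_set E x (st i w ` {m..}) {}"
  proof clarify
    fix k assume "m \<le> k"
    then show "st i w k \<in> step_set E x (st i w ` {m..}) {}"
      using st_less[OF assms w(1), of k] w
      by (auto simp: step_set_E ws_def omega_words_def intro!: bexI[of _ "w k"] image_eqI[of _ _ "Suc k"])
  qed
  then have "st i w ` {m..} \<subseteq> stay_set E x"
    unfolding stay_set_def by (rule gfp_upperbound)
  \<comment> \<open>The edge at position \<open>m\<close> is the good edge required by
    \<open>reach_set\<close>, so it is its target, at \<open>Suc m\<close>, that has to lie in the
    stay set.\<close>
  moreover have "st i w (Suc m) \<in> st i w ` {m..}"
    by (rule imageI) simp
  ultimately have "st i w (Suc m) \<in> stay_set E x"
    by blast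
  then show "i \<in> winI E x"
    using backward_reach[OF assms w(1), of x 0 m] w(2)[of m] by (simp add: winI_def)
next
  have stay: "\<exists>w\<in>words. ev_ge (ws j w) x" if j: "j \<in> stay_set E x" for j
  proof -
    have "\<exists>a\<in>set ls. x \<le> wt j a \<and> tgt j a \<in> stay_set E x" if "j \<in> stay_set E x" for j
      using that gfp_unfold[OF mono_step_set(2), of E x]
      unfolding stay_set_def by (auto simp: step_set_E)
    then obtain f where f: "\<And>j. j \<in> stay_set E x \<Longrightarrow> f j \<in> set ls \<and> x \<le> wt j (f j) \<and> tgt j (f j) \<in> stay_set E x"
      by metis
    obtain w where w: "w \<in> words" "\<And>m. st j w m \<in> stay_set E x" "\<And>m. w m = f (st j w m)"
      using word_of_strategy[of "stay_set E x" f j] f j by blast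
    then have "x \<le> ws j w m" for m
      using f[OF w(2)[of m]] by (simp add: ws_def)
    then show ?thesis
      using w(1) by (auto simp: ev_ge_def)
  qed
  have build: "\<exists>w\<in>words. ev_ge (ws j w) x"
    if a: "a \<in> set ls" and ex: "\<exists>w\<in>words. ev_ge (ws (tgt j a) w) x" for j a
  proof -
    obtain w where w: "w \<in> words" "ev_ge (ws (tgt j a) w) x"
      using ex by blast
    have "ev_ge (\<lambda>m. ws j (a ## w) (m + 1)) x"
      using w(2) by (simp only: ws_build)
    then have "ev_ge (ws j (a ## w)) x"
      by (simp only: threshold_value.acc_shift[OF threshold_value_LimInf])
    then show ?thesis
      using words_build[OF a w(1)] by blast
  qed
  assume "i \<in> winI E x"
  then have i: "i \<in> lfp (step_set E x (stay_set E x))"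
    by (simp add: winI_def reach_set_def)
  show "\<exists>w\<in>words. ev_ge (ws i w) x"
  proof (rule lfp_induct_set[OF i mono_step_set(1), where P = "\<lambda>j. \<exists>w\<in>words. ev_ge (ws j w) x"])
    fix j
    assume "j \<in> step_set E x (stay_set E x)
      (lfp (step_set E x (stay_set E x)) \<inter> {j. \<exists>w\<in>words. ev_ge (ws j w) x})"
    then obtain a where "a \<in> set ls" "\<exists>w\<in>words. ev_ge (ws (tgt j a) w) x"
      using stay unfolding step_set_E by blast
    then show "\<exists>w\<in>words. ev_ge (ws j w) x"
      by (rule build)
  qed
qed

end

text \<open>\<open>W\<close> hides which of the two fixpoints is used, so that the decomposition is
  proved once for both value functions.\<close>

locale det_game = det_graph ls n wt tgt + threshold_value Val acc
  for ls :: "'s list" and n wt tgt Val acc +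
  fixes W :: "rat \<Rightarrow> nat set"
  assumes W_iff: "i < n \<Longrightarrow> i \<in> W x \<longleftrightarrow> (\<exists>w\<in>words. acc (ws i w) x)"
begin

definition opt :: "nat \<Rightarrow> rat" where
  "opt = top_of W E"

lemma value_ws:
  assumes "i < n" "w \<in> words"
  obtains v where "v \<in> range (ws i w)" "Val (ws i w) = ereal (real_of_rat v)"
    "\<And>y. acc (ws i w) y \<longleftrightarrow> y \<le> v"
  using val_acc[OF finite_range_ws[OF assms]] by blast

lemma ws_in_weights:
  assumes "i < n" "w \<in> words"
  shows "\<exists>p k j. (p, k, ws i w m, j) \<in> E"
proof -
  obtain k where "k < length ls" "ls ! k = w m"
    using assms(2) by (auto simp: omega_words_def in_set_conv_nth)
  then have "(st i w m, k, ws i w m, tgt (st i w m) (w m)) \<in> E"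
    using st_less[OF assms, of m] unfolding E_def mem_Collect_eq
    by (intro exI[of _ "st i w m"] exI[of _ k]) (auto simp: ws_def)
  then show ?thesis by blast
qed

lemma finite_winning_weights: "finite {w. \<exists>p k j. (p, k, w, j) \<in> E \<and> i \<in> W w}"
  by (rule finite_subset[OF _ finite_imageI[OF finite_E, of "\<lambda>(p, k, w, j). w"]]) force

text \<open>Repeating one letter gives some run, and its value is a winning weight. Thus the maximum
  in \<open>top_of\<close> is meaningful as soon as there is a letter.\<close>

lemma winning_weights_nonempty:
  assumes "i < n" "ls \<noteq> []"
  shows "{w. \<exists>p k j. (p, k, w, j) \<in> E \<and> i \<in> W w} \<noteq> {}"
proof -
  define w where "w = (\<lambda>_ :: nat. hd ls)"
  have w: "w \<in> words"
    using assms(2) by (simp add: omega_words_def w_def)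
  obtain v where v: "v \<in> range (ws i w)" "\<And>y. acc (ws i w) y \<longleftrightarrow> y \<le> v"
    using value_ws[OF assms(1) w] by metis
  then have "i \<in> W v"
    using W_iff[OF assms(1)] w by blast
  then show ?thesis
    using ws_in_weights[OF assms(1) w] v(1) by blast
qed

lemma value_le_opt:
  assumes "i < n" "w \<in> words" "v \<in> range (ws i w)" "\<And>y. acc (ws i w) y \<longleftrightarrow> y \<le> v"
  shows "v \<le> opt i"
proof -
  have "i \<in> W v"
    using W_iff[OF assms(1)] assms by blast
  then show ?thesis
    unfolding opt_def top_of_def using ws_in_weights[OF assms(1,2)] assms(3)
    by (intro Max_ge finite_winning_weights) blast
qed

lemma opt_attained:
  assumes "i < n" "ls \<noteq> []"
  obtains w where "w \<in> words" "acc (ws i w) (opt i)"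
proof -
  have "opt i \<in> {w. \<exists>p k j. (p, k, w, j) \<in> E \<and> i \<in> W w}"
    unfolding opt_def top_of_def
    by (intro Max_in finite_winning_weights winning_weights_nonempty assms)
  then show ?thesis
    using that W_iff[OF assms(1)] by blast
qed

lemma acc_le_opt:
  assumes "i < n" "w \<in> words" "acc (ws i w) y"
  shows "y \<le> opt i"
  using value_ws[OF assms(1,2)] value_le_opt[OF assms(1,2)] assms(3) by (metis order_trans)

text \<open>An optimal word from the target stays accepted for the same threshold when
  \<open>a\<close> is put in front, by insensitivity to prefixes.\<close>

lemma opt_tgt_le:
  assumes "i < n" "a \<in> set ls"
  shows "opt (tgt i a) \<le> opt i"
proof -
  have "ls \<noteq> []"
    using assms(2) by auto
  then obtain w where w: "w \<in> words" "acc (ws (tgt i a) w) (opt (tgt i a))"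
    using opt_attained[OF tgt_less[OF assms]] by blast
  have "acc (\<lambda>m. ws i (a ## w) (m + 1)) (opt (tgt i a))"
    using w(2) by (simp only: ws_build)
  then have "acc (ws i (a ## w)) (opt (tgt i a))"
    by (simp only: acc_shift)
  then show ?thesis
    by (rule acc_le_opt[OF assms(1) words_build[OF assms(2) w(1)]])
qed

lemma opt_st_antimono:
  assumes "i < n" "w \<in> words" "k \<le> m"
  shows "opt (st i w m) \<le> opt (st i w k)"
  using assms(3)
proof (induction m rule: dec_induct)
  case (step m)
  have "opt (st i w (Suc m)) \<le> opt (st i w m)"
    using opt_tgt_le[OF st_less[OF assms(1,2)], of "w m" m] assms(2) by (simp add: omega_words_def)
  then show ?case using step.IH by simp
qed simp

lemma opt_st_limit:
  assumes "i < n" "w \<in> words"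
  shows "\<exists>T m0. (\<forall>m\<ge>m0. opt (st i w m) = T) \<and> (\<forall>m. T \<le> opt (st i w m))"
proof -
  have "range (\<lambda>m. opt (st i w m)) \<subseteq> opt ` {..<n}"
    using st_less[OF assms] by auto
  then have fin: "finite (range (\<lambda>m. opt (st i w m)))"
    by (rule finite_subset) simp
  define T where "T = Min (range (\<lambda>m. opt (st i w m)))"
  have "T \<in> range (\<lambda>m. opt (st i w m))"
    unfolding T_def using fin by (intro Min_in) auto
  then obtain m0 where m0: "T = opt (st i w m0)" by blast
  have T: "T \<le> opt (st i w m)" for m
    unfolding T_def using fin by simp
  show ?thesis
    using T m0 opt_st_antimono[OF assms, of m0] by (metis order_antisym)
qed

section \<open>The safety part and the liveness part\<close>

definition reweight :: "(rat \<Rightarrow> nat \<Rightarrow> rat) \<Rightarrow> nat \<Rightarrow> ('s, nat) qaut" where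
  "reweight g i = \<lparr>alphabet = set ls, states = {..<n}, initial = i,
     delta = \<lambda>p a. {(g (wt p a) (tgt p a), tgt p a)}\<rparr>"

definition rws :: "(rat \<Rightarrow> nat \<Rightarrow> rat) \<Rightarrow> nat \<Rightarrow> 's word \<Rightarrow> nat \<Rightarrow> rat" where
  "rws g i w m = g (ws i w m) (st i w (Suc m))"

lemma aut_val_reweight: "aut_val Val (reweight g i) w = Val (rws g i w)"
proof -
  have "runs (reweight g i) w = {(st i w, rws g i w)}"
  proof (intro equalityI subsetI)
    fix y assume y: "y \<in> runs (reweight g i) w"
    obtain q x where [simp]: "y = (q, x)" by (cases y)
    from y have r: "q 0 = i" "\<And>m. q (Suc m) = tgt (q m) (w m)" "\<And>m. x m = g (wt (q m) (w m)) (tgt (q m) (w m))"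
      by (auto simp: runs_def reweight_def)
    have "q m = st i w m" for m
      by (induction m) (auto simp: r)
    then show "y \<in> {(st i w, rws g i w)}"
      using r by (auto simp: rws_def ws_def)
  qed (auto simp: runs_def reweight_def rws_def ws_def)
  then show ?thesis by (simp add: aut_val_def)
qed

lemma finite_range_rws:
  assumes "i < n" "w \<in> words"
  shows "finite (range (rws g i w))"
proof (rule finite_subset)
  show "range (rws g i w) \<subseteq> (\<lambda>(x, p). g x p) ` (range (ws i w) \<times> {..<n})"
    using st_less[OF assms] by (auto simp: rws_def simp del: st.simps)
qed (use finite_range_ws[OF assms] in auto)

lemma quant_aut_reweight: "i < n \<Longrightarrow> quant_aut (reweight g i)"
  by (auto simp: quant_aut_def reweight_def tgt_less)

lemma deterministic_reweight: "deterministic (reweight g i)"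
  by (auto simp: deterministic_def reweight_def)

lemma alphabet_reweight [simp]: "alphabet (reweight g i) = set ls"
  by (simp add: reweight_def)

definition safety_part :: "nat \<Rightarrow> ('s, nat) qaut" where
  "safety_part i = reweight (\<lambda>x p. opt p) i"

definition liveness_part :: "nat \<Rightarrow> ('s, nat) qaut" where
  "liveness_part i = reweight (\<lambda>x p. if opt p \<le> x then opt i else x) i"

text \<open>\<open>T\<close> is the eventual value of \<open>opt\<close> along the run. On the tail
  the safety part has constant weight \<open>T\<close> and the liveness part cuts at
  \<open>T\<close>, so \<open>acc_const\<close> and \<open>acc_lift\<close> apply.\<close>

lemma value_parts:
  assumes "i < n" "w \<in> words"
  obtains v T where
    "Val (ws i w) = ereal (real_of_rat v)" "\<And>y. acc (ws i w) y \<longleftrightarrow> y \<le> v"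
    "aut_val Val (safety_part i) w = ereal (real_of_rat T)"
    "aut_val Val (liveness_part i) w = ereal (real_of_rat (if v = T then opt i else v))"
    "\<And>m. T \<le> opt (st i w m)" "\<exists>m0. \<forall>m\<ge>m0. opt (st i w m) = T" "v \<le> T"
proof -
  obtain v where v: "v \<in> range (ws i w)" "Val (ws i w) = ereal (real_of_rat v)"
    "\<And>y. acc (ws i w) y \<longleftrightarrow> y \<le> v"
    using value_ws[OF assms] by blast
  obtain T m0 where T: "\<And>m. m0 \<le> m \<Longrightarrow> opt (st i w m) = T" "\<And>m. T \<le> opt (st i w m)"
    using opt_st_limit[OF assms] by blast
  \<comment> \<open>The tail from \<open>m0\<close> on still meets the threshold \<open>v\<close>
    and starts in a state of optimum \<open>T\<close>.\<close>
  have "acc (\<lambda>m. ws i w (m + m0)) v"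
    by (simp only: acc_shift v(3) order_refl)
  then have "acc (ws (st i w m0) (suffix m0 w)) v"
    by (simp only: ws_suffix)
  from acc_le_opt[OF st_less[OF assms] words_suffix[OF assms(2)] this]
  have vT: "v \<le> T"
    using T(1)[of m0] by simp
  have TM: "T \<le> opt i"
    using T(2)[of 0] by simp
  have B: "Val (rws (\<lambda>x p. opt p) i w) = ereal (real_of_rat T)"
  proof (rule val_eqI[OF finite_range_rws[OF assms]])
    show "acc (rws (\<lambda>x p. opt p) i w) y \<longleftrightarrow> y \<le> T" for y
      using T(1) by (intro acc_const[of m0]) (simp add: rws_def del: st.simps)
  qed
  have C: "Val (rws (\<lambda>x p. if opt p \<le> x then opt i else x) i w) =
      ereal (real_of_rat (if v = T then opt i else v))"
  proof (rule val_eqI[OF finite_range_rws[OF assms]])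
    show "acc (rws (\<lambda>x p. if opt p \<le> x then opt i else x) i w) y \<longleftrightarrow>
        y \<le> (if v = T then opt i else v)" for y
      using T(1) by (intro acc_lift[OF v(3) vT TM, of m0]) (simp add: rws_def del: st.simps)
  qed
  show ?thesis
    using that[OF v(2,3)] B C T vT by (auto simp: safety_part_def liveness_part_def aut_val_reweight)
qed

text \<open>If \<open>v = T\<close>, the minimum is \<open>T\<close>, because
  \<open>T \<le> opt i\<close>; otherwise it is \<open>v\<close>, because
  \<open>v < T\<close>.\<close>

lemma min_parts:
  assumes "i < n" "w \<in> words"
  shows "Val (ws i w) = min (aut_val Val (safety_part i) w) (aut_val Val (liveness_part i) w)"
proof -
  obtain v T where vT: "Val (ws i w) = ereal (real_of_rat v)"
    "aut_val Val (safety_part i) w = ereal (real_of_rat T)"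
    "aut_val Val (liveness_part i) w = ereal (real_of_rat (if v = T then opt i else v))"
    "\<And>m. T \<le> opt (st i w m)" "v \<le> T"
    using value_parts[OF assms] by metis
  then show ?thesis
    using vT(4)[of 0] by (auto simp: min_def of_rat_less_eq)
qed

text \<open>Once \<open>opt\<close> has dropped to \<open>T\<close>, at position \<open>m0\<close>,
  it never rises again; this one prefix bounds all continuations by \<open>T\<close> and serves
  every threshold above.\<close>

lemma safe_safety_part:
  assumes "i < n"
  shows "safe_aut Val (safety_part i)"
  unfolding safe_aut_def
proof (intro ballI allI impI)
  have [simp]: "alphabet (safety_part i) = set ls" by (simp add: safety_part_def)
  fix w and r :: real
  assume w: "w \<in> omega_words (alphabet (safety_part i))" and r: "aut_val Val (safety_part i) w < ereal r"
  then have w: "w \<in> words" by simp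
  obtain T m0 where T: "aut_val Val (safety_part i) w = ereal (real_of_rat T)"
    "opt (st i w m0) = T"
    using value_parts[OF assms w] by (metis order_refl)
  have "aut_val Val (safety_part i) (prefix m0 w \<frown> w') \<le> ereal (real_of_rat T)" if w': "w' \<in> words" for w'
  proof -
    obtain T' where T': "aut_val Val (safety_part i) (prefix m0 w \<frown> w') = ereal (real_of_rat T')"
      "\<And>m. T' \<le> opt (st i (prefix m0 w \<frown> w') m)"
      using value_parts[OF assms words_conc[OF w w']] by metis
    from T'(2)[of m0] have "T' \<le> T"
      using T(2) by (simp add: st_conc)
    then show ?thesis
      by (simp add: T'(1) of_rat_less_eq)
  qed
  then have "(SUP w'\<in>words. aut_val Val (safety_part i) (prefix m0 w \<frown> w')) \<le> ereal (real_of_rat T)"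
    by (rule SUP_least)
  then show "\<exists>u. u \<prec> w \<and>
      (SUP w'\<in>omega_words (alphabet (safety_part i)). aut_val Val (safety_part i) (u \<frown> w')) < ereal r"
    using r T(1) by (intro exI[of _ "prefix m0 w"]) (auto simp: strict_prefix_of_def intro: le_less_trans)
qed

text \<open>The witness is \<open>T\<close>. The top value is at most \<open>opt i\<close>, which
  rules out \<open>v = T\<close>, so \<open>T\<close> exceeds the value of \<open>w\<close>. After
  any prefix an optimal continuation has original value at least \<open>T\<close>, and the liveness
  part never lowers a value.\<close>

lemma live_liveness_part:
  assumes "i < n"
  shows "live_aut Val (liveness_part i)"
  unfolding live_aut_def
proof (intro ballI impI)
  have [simp]: "alphabet (liveness_part i) = set ls" by (simp add: liveness_part_def)
  fix w
  assume w: "w \<in> omega_words (alphabet (liveness_part i))"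
    and less: "aut_val Val (liveness_part i) w < top_val Val (liveness_part i)"
  then have w: "w \<in> words" by simp
  obtain v T where vT: "aut_val Val (liveness_part i) w = ereal (real_of_rat (if v = T then opt i else v))"
    "\<And>m. T \<le> opt (st i w m)" "v \<le> T"
    using value_parts[OF assms w] by metis
  have "top_val Val (liveness_part i) \<le> ereal (real_of_rat (opt i))"
    unfolding top_val_def
  proof (rule SUP_least)
    fix w' assume "w' \<in> omega_words (alphabet (liveness_part i))"
    then have w': "w' \<in> words" by simp
    obtain v' T' where vT': "aut_val Val (liveness_part i) w' = ereal (real_of_rat (if v' = T' then opt i else v'))"
      "\<And>m. T' \<le> opt (st i w' m)" "v' \<le> T'"
      using value_parts[OF assms w'] by metis
    then show "aut_val Val (liveness_part i) w' \<le> ereal (real_of_rat (opt i))"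
      using vT'(2)[of 0] by (auto simp: of_rat_less_eq)
  qed
  with less vT(1) have "v \<noteq> T"
    by auto
  have "ereal (real_of_rat T) \<le> (SUP w'\<in>words. aut_val Val (liveness_part i) (prefix k w \<frown> w'))" for k
  proof -
    have "ls \<noteq> []"
      using w by (auto simp: omega_words_def)
    then obtain w' where w': "w' \<in> words" "acc (ws (st i w k) w') (opt (st i w k))"
      using opt_attained[OF st_less[OF assms w]] by blast
    let ?w = "prefix k w \<frown> w'"
    have w2: "?w \<in> words" by (rule words_conc[OF w w'(1)])
    have "suffix k ?w = w'" by (simp add: suffix_conc_length[of "prefix k w", simplified])
    then have "ws (st i w k) w' = (\<lambda>m. ws i ?w (m + k))"
      using ws_suffix[of i ?w k] st_conc[of k k i w w'] by simp
    then have "acc (\<lambda>m. ws i ?w (m + k)) (opt (st i w k))"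
      using w'(2) by simp
    then have "acc (ws i ?w) (opt (st i w k))"
      by (simp only: acc_shift)
    obtain v' T' where vT': "\<And>y. acc (ws i ?w) y \<longleftrightarrow> y \<le> v'"
      "aut_val Val (liveness_part i) ?w = ereal (real_of_rat (if v' = T' then opt i else v'))"
      "\<And>m. T' \<le> opt (st i ?w m)" "v' \<le> T'"
      using value_parts[OF assms w2] by metis
    have "T \<le> v'"
      using vT'(1) \<open>acc (ws i ?w) (opt (st i w k))\<close> vT(2)[of k] by (meson order_trans)
    also have "v' \<le> (if v' = T' then opt i else v')"
      using vT'(3)[of 0] vT'(4) by auto
    finally have "ereal (real_of_rat T) \<le> aut_val Val (liveness_part i) ?w"
      by (simp only: vT'(2) ereal_less_eq of_rat_less_eq)
    also have "\<dots> \<le> (SUP w'\<in>words. aut_val Val (liveness_part i) (prefix k w \<frown> w'))"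
      using w'(1) by (rule SUP_upper)
    finally show ?thesis .
  qed
  then show "\<exists>r::real. aut_val Val (liveness_part i) w < ereal r \<and> (\<forall>u. u \<prec> w \<longrightarrow>
      ereal r \<le> (SUP w'\<in>omega_words (alphabet (liveness_part i)). aut_val Val (liveness_part i) (u \<frown> w')))"
    using vT(1,3) \<open>v \<noteq> T\<close>
    by (intro exI[of _ "real_of_rat T"]) (auto simp: strict_prefix_of_def of_rat_less)
qed

end

section \<open>Representations and their size\<close>

context det_graph
begin

lemma aut_val_eq:
  assumes "i < n" "w \<in> words" "initial A = qs ! i"
    and "\<And>p a. p < n \<Longrightarrow> a \<in> set ls \<Longrightarrow> delta A (qs ! p) a = {(wt p a, qs ! tgt p a)}"
  shows "aut_val V A w = V (ws i w)"
proof -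
  have w: "w m \<in> set ls" for m
    using assms(2) by (simp add: omega_words_def)
  have d: "delta A (qs ! st i w m) (w m) = {(ws i w m, qs ! st i w (Suc m))}" for m
    using assms(4)[OF st_less[OF assms(1,2)] w] by (simp add: ws_def)
  have "runs A w = {(\<lambda>m. qs ! st i w m, ws i w)}"
  proof (intro equalityI subsetI)
    fix y assume y: "y \<in> runs A w"
    obtain q x where [simp]: "y = (q, x)" by (cases y)
    from y have r: "q 0 = initial A" "\<And>m. (x m, q (Suc m)) \<in> delta A (q m) (w m)"
      by (auto simp: runs_def)
    have q: "q m = qs ! st i w m" for m
    proof (induction m)
      case (Suc m)
      show ?case using r(2)[of m] d[of m] by (simp add: Suc)
    qed (simp add: r assms(3))
    have "x m = ws i w m" for m
      using r(2)[of m] d[of m] by (simp add: q)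
    then show "y \<in> {(\<lambda>m. qs ! st i w m, ws i w)}"
      using q by auto
  next
    fix y assume "y \<in> {(\<lambda>m. qs ! st i w m, ws i w)}"
    then show "y \<in> runs A w"
      using d by (auto simp: runs_def assms(3) simp del: st.simps(2))
  qed
  then show ?thesis by (simp add: aut_val_def)
qed

end

context det_game
begin

lemma represents_reweight:
  assumes "distinct ls" "distinct ts" "set ts = E" "i < n"
  shows "represents (tree_of_list [tree_of_nat (length ls), tree_of_nat n, tree_of_nat i,
      tree_of_transitions (rev (map (\<lambda>(i, k, x, j). (i, k, g x j, j)) ts))]) ls [0..<n] (reweight g i)"
proof -
  let ?f = "\<lambda>(i, k, x, j). (i, k, g x j, j)"
  let ?ts = "rev (map ?f ts)"
  \<comment> \<open>Even if \<open>g\<close> merges weights, source and letter already determine a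
    transition of \<open>E\<close>.\<close>
  have "inj_on ?f E"
    by (auto simp: inj_on_def E_def)
  then have "distinct ?ts"
    using assms(2,3) by (simp add: distinct_map)
  moreover have "set ?ts = {(p, k, x, j). p < length [0..<n] \<and> k < length ls \<and> j < length [0..<n] \<and>
      (x, [0..<n] ! j) \<in> delta (reweight g i) ([0..<n] ! p) (ls ! k)}"
  proof -
    have "set ?ts = ?f ` E"
      using assms(3) by simp
    also have "\<dots> = {(p, k, g (wt p (ls ! k)) (tgt p (ls ! k)), tgt p (ls ! k)) |p k. p < n \<and> k < length ls}"
      by (force simp: E_def)
    finally show ?thesis
      using tgt_less by (auto simp: reweight_def)
  qed
  ultimately show ?thesis
    unfolding represents_def tree_of_transitions_def
    using assms(1,4) by (intro conjI exI[of _ i] exI[of _ ?ts]) (auto simp: reweight_def)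
qed

lemma decompT_eq:
  assumes win: "\<And>x. represents_set (win (tree_of_transitions ts) (tree_of_rat x)) (W x)"
    and ts: "set ts = E" and "i < n"
  defines "h \<equiv> \<lambda>g. tree_of_list [tree_of_nat (length ls), tree_of_nat n, tree_of_nat i,
      tree_of_transitions (rev (map (\<lambda>(i, k, x, j). (i, k, g x j, j)) ts))]"
  shows "decompT win (tree_of_list [tree_of_nat (length ls), tree_of_nat n, tree_of_nat i,
      tree_of_transitions ts]) =
    Cell (h (\<lambda>x p. opt p)) (h (\<lambda>x p. if opt p \<le> x then opt i else x))"
proof -
  \<comment> \<open>With an empty alphabet \<open>topT\<close> would return the atom, which is no
    weight; but then there are no transitions and it is never written to the output.\<close>
  have opt: "topT win (tree_of_transitions ts) (tree_of_nat p) = tree_of_rat (opt p)"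
    if "ls \<noteq> []" "p < n" for p
    using winning_weights_nonempty[OF that(2,1)]
    by (simp only: topT_eq[where win = win and W = W, OF win] ts opt_def if_False)
  have tgt: "j < n" "ls \<noteq> []" if "(p, k, x, j) \<in> E" for p k x j
    using that tgt_less by (auto simp: E_def)
  have le: "leQ (tree_of_rat x) (tree_of_rat y) = Atom \<longleftrightarrow> \<not> x \<le> y" for x y
    using leQ_iff by blast
  have "safeT win (tree_of_transitions ts) = tree_of_transitions (rev (map (\<lambda>(i, k, x, j). (i, k, opt j, j)) ts))"
    unfolding safeT_def
    by (subst reweightT_eq[where h = "\<lambda>(i, k, x, j). opt j"])
      (use tgt in \<open>auto simp: ts opt split_def simp del: tree_of_transition.simps\<close>)
  moreover have "liveT win (tree_of_nat i) (tree_of_transitions ts) =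
      tree_of_transitions (rev (map (\<lambda>(p, k, x, j). (p, k, if opt j \<le> x then opt i else x, j)) ts))"
    unfolding liveT_def
    by (subst reweightT_eq[where h = "\<lambda>(p, k, x, j). if opt j \<le> x then opt i else x"])
      (use tgt assms(3) in \<open>auto simp: ts opt split_def ifT_def le simp del: tree_of_transition.simps\<close>)
  ultimately show ?thesis
    by (simp add: decompT_def h_def Let_def)
qed

end

section \<open>Size of a representation\<close>

lemma length_bits_le: "length (bits n) \<le> n"
proof (induction n rule: bits.induct)
  case (1 n)
  then show ?case
    by (subst bits.simps) (cases "n = 0"; fastforce)
qed

lemma nodes_tree_of_nat: "nodes (tree_of_nat n) \<le> 4 * length (bits n) + 1"
proof -
  have "nodes (tree_of_list (map tree_of_bool bs)) \<le> 4 * length bs + 1" for bs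
    by (induction bs) (auto simp: tree_of_bool_def)
  then show ?thesis by (simp add: tree_of_nat_def)
qed

lemma nodes_tree_of_nat_le: "n \<le> N \<Longrightarrow> nodes (tree_of_nat n) \<le> 4 * N + 1"
  using nodes_tree_of_nat[of n] length_bits_le[of n] by simp

lemma nodes_tree_of_rat: "nodes (tree_of_rat x) \<le> 4 * weight_size x + 7"
proof -
  obtain a b where "quotient_of x = (a, b)" by (cases "quotient_of x")
  then show ?thesis
    using nodes_tree_of_nat[of "nat \<bar>a\<bar>"] nodes_tree_of_nat[of "nat b"]
    by (auto simp: tree_of_rat_def tree_of_int_def weight_size_def tree_of_bool_def)
qed

lemma nodes_tree_of_list: "nodes (tree_of_list ts) = 1 + (\<Sum>t\<leftarrow>ts. nodes t + 1)"
  by (induction ts) auto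

lemma weight_size_pos: "1 \<le> weight_size x"
  by (simp add: weight_size_def split: prod.splits)

text \<open>With \<open>N\<close> the size, a name takes at most \<open>4 * N + 1\<close> nodes, so
  a listed transition takes \<open>12 * N + 16\<close> plus four times its weight size. The rest is
  three numbers and five nodes of the outer list.\<close>

lemma nodes_representation:
  assumes "quant_aut A" "represents t ls qs A"
  shows "nodes t \<le> poly [:9, 32, 12:] (aut_size A)"
proof -
  obtain i ts where ls: "distinct ls" "set ls = alphabet A" and qs: "distinct qs" "set qs = states A"
    and i: "i < length qs" and ts: "distinct ts"
      "set ts = {(i, k, x, j). i < length qs \<and> k < length ls \<and> j < length qs \<and>
                    (x, qs ! j) \<in> delta A (qs ! i) (ls ! k)}"
    and t: "t = tree_of_list [tree_of_nat (length ls), tree_of_nat (length qs), tree_of_nat i,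
              tree_of_list (map tree_of_transition ts)]"
    using assms(2) unfolding represents_def by blast
  define N where "N = aut_size A"
  define f where "f = (\<lambda>(i, k, x :: rat, j). (qs ! i, ls ! k, x, qs ! j))"
  have ls_le: "length ls \<le> N" and qs_le: "length qs \<le> N"
    using distinct_card[OF ls(1)] distinct_card[OF qs(1)] ls qs by (auto simp: N_def aut_size_def)
  have inj: "inj_on f (set ts)"
    using ls(1) qs(1) by (auto simp: inj_on_def f_def ts(2) nth_eq_iff_index_eq)
  have "transitions A = f ` set ts"
  proof (intro equalityI subsetI)
    fix y assume "y \<in> transitions A"
    then obtain q a x q' where y: "y = (q, a, x, q')" "q \<in> states A" "a \<in> alphabet A" "(x, q') \<in> delta A q a"
      by (auto simp: transitions_def)
    with assms(1) have "q' \<in> states A"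
      by (auto simp: quant_aut_def)
    with y ls(2) qs(2) obtain i k j where "i < length qs" "qs ! i = q" "k < length ls" "ls ! k = a"
      "j < length qs" "qs ! j = q'"
      by (metis in_set_conv_nth)
    with y have "(i, k, x, j) \<in> set ts" "y = f (i, k, x, j)"
      by (auto simp: ts(2) f_def)
    then show "y \<in> f ` set ts" by blast
  qed (use ls(2) qs(2) in \<open>auto simp: transitions_def f_def ts(2)\<close>)
  then have "(\<Sum>(q, a, x, q')\<in>transitions A. weight_size x) = (\<Sum>(i, k, x, j)\<in>set ts. weight_size x)"
    by (simp only: sum.reindex[OF inj]) (rule sum.cong, auto simp: f_def)
  then have ws: "(\<Sum>(i, k, x, j)\<leftarrow>ts. weight_size x) \<le> N"
    by (simp add: sum_list_distinct_conv_sum_set[OF ts(1)] N_def aut_size_def)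
  \<comment> \<open>Every weight has size at least one, so the total weight size also bounds the
    number of transitions.\<close>
  have len: "length us \<le> (\<Sum>(i, k, x, j)\<leftarrow>us. weight_size x)" for us :: "(nat \<times> nat \<times> rat \<times> nat) list"
  proof (induction us)
    case (Cons e us)
    obtain i k x j where "e = (i, k, x, j)" by (cases e)
    then show ?case
      using Cons weight_size_pos[of x] by simp
  qed simp
  have tr: "nodes (tree_of_transition e) + 1 \<le> (12 * N + 16) + 4 * (case e of (i, k, x, j) \<Rightarrow> weight_size x)"
    if "e \<in> set ts" for e
  proof -
    obtain p k x j where e: "e = (p, k, x, j)" by (cases e)
    then have "p \<le> N" "k \<le> N" "j \<le> N"
      using that ls_le qs_le by (auto simp: ts(2))
    then show ?thesis
      using nodes_tree_of_nat_le[of p N] nodes_tree_of_nat_le[of k N] nodes_tree_of_nat_le[of j N]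
        nodes_tree_of_rat[of x] by (simp add: e)
  qed
  have "nodes (tree_of_list (map tree_of_transition ts)) =
      1 + (\<Sum>e\<leftarrow>ts. nodes (tree_of_transition e) + 1)"
    by (simp add: nodes_tree_of_list o_def)
  also have "\<dots> \<le> 1 + (\<Sum>e\<leftarrow>ts. (12 * N + 16) + 4 * (case e of (i, k, x, j) \<Rightarrow> weight_size x))"
    using tr by (intro add_left_mono sum_list_mono) auto
  also have "\<dots> = 1 + length ts * (12 * N + 16) + 4 * (\<Sum>(i, k, x, j)\<leftarrow>ts. weight_size x)"
    by (simp add: sum_list_addf sum_list_const_mult sum_list_triv algebra_simps)
  also have "\<dots> \<le> 1 + N * (12 * N + 16) + 4 * N"
    using ws len[of ts] by (intro add_mono mult_mono) auto
  finally have "nodes (tree_of_list (map tree_of_transition ts)) \<le> 1 + N * (12 * N + 16) + 4 * N" .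
  moreover have "nodes (tree_of_nat (length ls)) \<le> 4 * N + 1" "nodes (tree_of_nat (length qs)) \<le> 4 * N + 1"
    "nodes (tree_of_nat i) \<le> 4 * N + 1"
    by (rule nodes_tree_of_nat_le; use ls_le qs_le i in simp)+
  ultimately show ?thesis
    by (simp add: t algebra_simps flip: N_def)
qed

text \<open>Acceptance condition, fixpoint and program are parameters, so both value functions are
  instances. \<open>W\<close> is required to be correct for all graphs over these letters because
  the graph is only extracted from \<open>A\<close> inside the proof.\<close>

lemma decomposition:
  fixes A :: "('s, 'q) qaut" and win :: "tree \<Rightarrow> tree \<Rightarrow> tree" and W :: "edges \<Rightarrow> rat \<Rightarrow> nat set"
  assumes acc: "threshold_value Val acc"
    and W: "\<And>(ls :: 's list) n wt tgt i x. det_graph ls n tgt \<Longrightarrow> i < n \<Longrightarrow>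
      i \<in> W (det_graph.E ls n wt tgt) x \<longleftrightarrow>
        (\<exists>w\<in>omega_words (set ls). acc (det_graph.ws wt tgt i w) x)"
    and win: "\<And>ts x. represents_set (win (tree_of_transitions ts) (tree_of_rat x)) (W (set ts) x)"
    and A: "quant_aut A" "deterministic A" "represents t ls qs A"
  shows "\<exists>(B :: ('s, nat) qaut) (C :: ('s, nat) qaut) qsB qsC tB tC.
    decompT win t = Cell tB tC \<and>
    represents tB ls qsB B \<and> represents tC ls qsC C \<and>
    quant_aut B \<and> alphabet B = alphabet A \<and> deterministic B \<and> safe_aut Val B \<and>
    quant_aut C \<and> alphabet C = alphabet A \<and> deterministic C \<and> live_aut Val C \<and>
    (\<forall>w\<in>omega_words (alphabet A). aut_val Val A w = min (aut_val Val B w) (aut_val Val C w))"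
proof -
  obtain i ts where ls: "distinct ls" "set ls = alphabet A" and qs: "distinct qs" "set qs = states A"
    and i: "i < length qs" "qs ! i = initial A" and ts: "distinct ts"
      "set ts = {(i, k, x, j). i < length qs \<and> k < length ls \<and> j < length qs \<and>
                    (x, qs ! j) \<in> delta A (qs ! i) (ls ! k)}"
    and t: "t = tree_of_list [tree_of_nat (length ls), tree_of_nat (length qs), tree_of_nat i,
              tree_of_transitions ts]"
    using A(3) unfolding represents_def tree_of_transitions_def by blast
  define n where "n = length qs"
  have "\<exists>x j. j < n \<and> delta A (qs ! p) a = {(x, qs ! j)}" if "p < n" "a \<in> set ls" for p a
  proof -
    have "qs ! p \<in> states A" "a \<in> alphabet A"
      using that ls(2) qs(2) by (auto simp: n_def)
    then have "is_singleton (delta A (qs ! p) a)" and sub: "delta A (qs ! p) a \<subseteq> UNIV \<times> states A"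
      using A(1,2) by (auto simp: quant_aut_def deterministic_def)
    then obtain x q where d: "delta A (qs ! p) a = {(x, q)}"
      by (auto simp: is_singleton_def)
    with sub have "q \<in> set qs"
      using qs(2) by simp
    then obtain j where "j < n" "qs ! j = q"
      by (auto simp: in_set_conv_nth n_def)
    with d show ?thesis by blast
  qed
  then obtain wt tgt where tgt: "\<And>p a. p < n \<Longrightarrow> a \<in> set ls \<Longrightarrow>
      tgt p a < n \<and> delta A (qs ! p) a = {(wt p a, qs ! tgt p a)}"
    by metis
  interpret det_graph ls n wt tgt
    by unfold_locales (use tgt in blast)
  interpret threshold_value Val acc
    by (rule acc)
  interpret det_game ls n wt tgt Val acc "W E"
    by unfold_locales (rule W[OF det_graph_axioms])
  have E: "set ts = E"
  proof (intro equalityI subsetI)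
    fix e assume "e \<in> set ts"
    then obtain p k x j where e: "e = (p, k, x, j)" "p < n" "k < length ls" "j < n"
      "(x, qs ! j) \<in> delta A (qs ! p) (ls ! k)"
      by (auto simp: ts(2) n_def)
    with tgt[of p "ls ! k"] have "x = wt p (ls ! k)" "j = tgt p (ls ! k)"
      using qs(1) by (auto simp: n_def nth_eq_iff_index_eq)
    with e show "e \<in> E" by (auto simp: E_def)
  next
    fix e assume "e \<in> E"
    then show "e \<in> set ts"
      using tgt by (auto simp: E_def ts(2)[folded n_def])
  qed
  have i_less: "i < n" using i by (simp add: n_def)
  let ?h = "\<lambda>g. tree_of_list [tree_of_nat (length ls), tree_of_nat n, tree_of_nat i,
      tree_of_transitions (rev (map (\<lambda>(i, k, x, j). (i, k, g x j, j)) ts))]"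
  have dec: "decompT win t =
      Cell (?h (\<lambda>x p. opt p)) (?h (\<lambda>x p. if opt p \<le> x then opt i else x))"
    unfolding t n_def[symmetric]
    by (rule decompT_eq[OF _ E i_less]) (use win[of ts] E in simp)
  have rep: "represents (?h g) ls [0..<n] (reweight g i)" for g
    by (rule represents_reweight[OF ls(1) ts(1) E i_less])
  have min: "aut_val Val A w = min (aut_val Val (safety_part i) w) (aut_val Val (liveness_part i) w)"
    if "w \<in> words" for w
    using aut_val_eq[OF i_less that, of A qs Val] min_parts[OF i_less that] tgt i(2) by simp
  show ?thesis
    by (rule exI[of _ "safety_part i"], rule exI[of _ "liveness_part i"],
        intro exI[of _ "[0..<n]"] exI conjI, rule dec)
      (use rep min quant_aut_reweight[OF i_less] safe_safety_part[OF i_less] live_liveness_part[OF i_less]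
        in \<open>auto simp: safety_part_def liveness_part_def deterministic_reweight ls(2)\<close>)
qed

theorem theorem9p4:
  fixes Val :: value_function
  assumes "Val \<in> {LimInf, LimSup}"
  shows "\<exists>(P :: com) (p :: nat poly).
    \<forall>(A :: ('s, 'q) qaut) ls qs t.
      quant_aut A \<and> deterministic A \<and> represents t ls qs A \<longrightarrow>
      (\<exists>(B :: ('s, nat) qaut) (C :: ('s, nat) qaut) qsB qsC tB tC.
        computes_within P t (poly p (aut_size A)) (Cell tB tC) \<and>
        represents tB ls qsB B \<and> represents tC ls qsC C \<and>
        quant_aut B \<and> alphabet B = alphabet A \<and> deterministic B \<and> safe_aut Val B \<and>
        quant_aut C \<and> alphabet C = alphabet A \<and> deterministic C \<and> live_aut Val C \<and>
        (\<forall>w\<in>omega_words (alphabet A).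
           aut_val Val A w = min (aut_val Val B w) (aut_val Val C w)))"
proof -
  \<comment> \<open>\<open>win\<close> is fixed before \<open>A\<close>, so that one program and one
    polynomial serve all automata.\<close>
  have "\<exists>win. ptime (decompT win) \<and> (\<forall>(A :: ('s, 'q) qaut) ls qs t.
      quant_aut A \<and> deterministic A \<and> represents t ls qs A \<longrightarrow>
      (\<exists>(B :: ('s, nat) qaut) (C :: ('s, nat) qaut) qsB qsC tB tC.
        decompT win t = Cell tB tC \<and>
        represents tB ls qsB B \<and> represents tC ls qsC C \<and>
        quant_aut B \<and> alphabet B = alphabet A \<and> deterministic B \<and> safe_aut Val B \<and>
        quant_aut C \<and> alphabet C = alphabet A \<and> deterministic C \<and> live_aut Val C \<and>
        (\<forall>w\<in>omega_words (alphabet A).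
           aut_val Val A w = min (aut_val Val B w) (aut_val Val C w))))"
  proof (cases "Val = LimInf")
    case True
    show ?thesis
      unfolding True
      by (intro exI[of _ winI_T] conjI allI impI ptime_decompT ptime_winI_T
          decomposition[where win = winI_T and W = winI and acc = ev_ge]
          threshold_value_LimInf det_graph.winI_iff represents_winI_T) auto
  next
    case False
    then have "Val = LimSup" using assms by simp
    then show ?thesis
      by (intro exI[of _ winS_T] conjI allI impI ptime_decompT ptime_winS_T
          decomposition[where win = winS_T and W = winS and acc = io_ge]
          det_graph.winS_iff represents_winS_T) (auto simp: threshold_value_LimSup)
  qed
  then obtain win where ptime: "ptime (decompT win)" and dec:
    "\<And>(A :: ('s, 'q) qaut) ls qs t. quant_aut A \<and> deterministic A \<and> represents t ls qs A \<Longrightarrow>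
      (\<exists>(B :: ('s, nat) qaut) (C :: ('s, nat) qaut) qsB qsC tB tC.
        decompT win t = Cell tB tC \<and>
        represents tB ls qsB B \<and> represents tC ls qsC C \<and>
        quant_aut B \<and> alphabet B = alphabet A \<and> deterministic B \<and> safe_aut Val B \<and>
        quant_aut C \<and> alphabet C = alphabet A \<and> deterministic C \<and> live_aut Val C \<and>
        (\<forall>w\<in>omega_words (alphabet A).
           aut_val Val A w = min (aut_val Val B w) (aut_val Val C w)))"
    by blast
  obtain P p where P: "\<And>t. computes_within P t (poly p (nodes t)) (decompT win t)"
    using ptime_computes[OF ptime] by blast
  have "computes_within P t (poly (pcompose p [:9, 32, 12:]) (aut_size A)) (decompT win t)"
    if "quant_aut A" "represents t ls qs A" for A :: "('s, 'q) qaut" and ls qs t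
    using P[of t] poly_nat_mono[OF nodes_representation[OF that], of p]
    unfolding computes_within_def poly_pcompose by (meson order_trans)
  then show ?thesis
    using dec by (intro exI[of _ P] exI[of _ "pcompose p [:9, 32, 12:]"] allI impI) metis
qed

end
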